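(* Let $u_0(x) = \tanh(x/\sqrt{2})$ and $\Lambda = S - 2E$, where $E$ and $S$ are the functionals given in the context. The second variation of $\Lambda$ at $u_0$ is nonnegative for perturbations in $H^2(\mathbb{R})$; that is, for all real-valued $u,v \in H^2(\mathbb{R})$, $$ \langle \Lambda''(u_0)[u,v],[u,v]\rangle := \frac{d^2}{ds^2}\Big|_{s=0}\Lambda\bigl(u_0 + s(u+iv)\bigr) \ge 0 . $$
   Context: For complex-valued $\psi$ in $X = \{\psi \in H^2_{\rm loc}(\mathbb{R}) : \psi_x \in H^1(\mathbb{R}),\ 1-|\psi|^2 \in L^2(\mathbb{R})\}$ (which contains $u_0 + H^2(\mathbb{R})$), define $$ E(\psi) = \int_{\mathbb{R}} \Bigl(|\psi_x|^2 + \tfrac12(1-|\psi|^2)^2\Bigr)\,dx, $$ $$ S(\psi) = \int_{\mathbb{R}} \Bigl(|\psi_{xx}|^2 + 3|\psi|^2|\psi_x|^2 + \tfrac12(\bar\psi\psi_x + \psi\bar\psi_x)^2 + (1-|\psi|^2)^2\bigl(1+\tfrac12|\psi|^2\bigr)\Bigr)\,dx, $$ $$ \Lambda(\psi) = S(\psi) - 2E(\psi). $$ *)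

theory Defs
  imports "HOL-Analysis.Analysis"
begin

text \<open>
  Elements of \<open>L\<^sup>2\<close> and of Sobolev spaces are represented by Borel measurable functions; every notion
  below is invariant under modification on a null set.
\<close>

definition test_function :: "(real \<Rightarrow> real) \<Rightarrow> bool" where
  "test_function \<phi> \<longleftrightarrow>
     (\<forall>n x. (deriv ^^ n) \<phi> differentiable (at x)) \<and> compact (closure {x. \<phi> x \<noteq> 0})"

definition locally_integrable :: "(real \<Rightarrow> 'a::euclidean_space) \<Rightarrow> bool" where
  "locally_integrable f \<longleftrightarrow>
     f \<in> borel_measurable lborel \<and> (\<forall>a b. set_integrable lborel {a..b} f)"

definition has_weak_deriv ::
    "(real \<Rightarrow> 'a::euclidean_space) \<Rightarrow> (real \<Rightarrow> 'a) \<Rightarrow> bool" where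
  "has_weak_deriv f g \<longleftrightarrow>
     locally_integrable f \<and> locally_integrable g \<and>
     (\<forall>\<phi>. test_function \<phi> \<longrightarrow>
        (\<integral>x. deriv \<phi> x *\<^sub>R f x \<partial>lborel) = - (\<integral>x. \<phi> x *\<^sub>R g x \<partial>lborel))"

text \<open>The weak derivative is unique almost everywhere, so the choice does not affect integrals.\<close>

definition weak_deriv :: "(real \<Rightarrow> 'a::euclidean_space) \<Rightarrow> real \<Rightarrow> 'a" where
  "weak_deriv f = (SOME g. has_weak_deriv f g)"

definition L2 :: "(real \<Rightarrow> 'a::euclidean_space) set" where
  "L2 = {f. f \<in> borel_measurable lborel \<and> integrable lborel (\<lambda>x. (norm (f x))\<^sup>2)}"

definition L2_loc :: "(real \<Rightarrow> 'a::euclidean_space) set" where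
  "L2_loc = {f. f \<in> borel_measurable lborel \<and>
               (\<forall>a b. set_integrable lborel {a..b} (\<lambda>x. (norm (f x))\<^sup>2))}"

primrec sobolev_H :: "nat \<Rightarrow> (real \<Rightarrow> 'a::euclidean_space) set" where
  "sobolev_H 0 = L2"
| "sobolev_H (Suc k) = {f \<in> L2. \<exists>g \<in> sobolev_H k. has_weak_deriv f g}"

primrec sobolev_H_loc :: "nat \<Rightarrow> (real \<Rightarrow> 'a::euclidean_space) set" where
  "sobolev_H_loc 0 = L2_loc"
| "sobolev_H_loc (Suc k) = {f \<in> L2_loc. \<exists>g \<in> sobolev_H_loc k. has_weak_deriv f g}"

definition X :: "(real \<Rightarrow> complex) set" where
  "X = {\<psi> \<in> sobolev_H_loc 2. weak_deriv \<psi> \<in> sobolev_H 1 \<and> (\<lambda>x. 1 - (cmod (\<psi> x))\<^sup>2) \<in> L2}"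

definition E :: "(real \<Rightarrow> complex) \<Rightarrow> real" where
  "E \<psi> = (\<integral>x. (cmod (weak_deriv \<psi> x))\<^sup>2 + 1/2 * (1 - (cmod (\<psi> x))\<^sup>2)\<^sup>2 \<partial>lborel)"

text \<open>The argument of \<open>Re\<close> is real, being the sum of a number and its conjugate.\<close>

definition S :: "(real \<Rightarrow> complex) \<Rightarrow> real" where
  "S \<psi> = (\<integral>x. (cmod (weak_deriv (weak_deriv \<psi>) x))\<^sup>2
               + 3 * (cmod (\<psi> x))\<^sup>2 * (cmod (weak_deriv \<psi> x))\<^sup>2
               + 1/2 * (Re (cnj (\<psi> x) * weak_deriv \<psi> x + \<psi> x * cnj (weak_deriv \<psi> x)))\<^sup>2
               + (1 - (cmod (\<psi> x))\<^sup>2)\<^sup>2 * (1 + 1/2 * (cmod (\<psi> x))\<^sup>2) \<partial>lborel)"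

definition Lam :: "(real \<Rightarrow> complex) \<Rightarrow> real" where
  "Lam \<psi> = S \<psi> - 2 * E \<psi>"

definition u0 :: "real \<Rightarrow> complex" where
  "u0 x = complex_of_real (tanh (x / sqrt 2))"

definition perturb :: "(real \<Rightarrow> complex) \<Rightarrow> (real \<Rightarrow> complex) \<Rightarrow> real \<Rightarrow> real \<Rightarrow> complex" where
  "perturb \<psi> h s = (\<lambda>x. \<psi> x + complex_of_real s * h x)"

text \<open>
  \<open>deriv\<close> is total, so the existence of the second derivative has to be asserted separately from
  statements about its value.
\<close>

definition twice_differentiable_at :: "(real \<Rightarrow> real) \<Rightarrow> real \<Rightarrow> bool" where
  "twice_differentiable_at F a \<longleftrightarrow>
     (\<forall>\<^sub>F s in nhds a. F differentiable (at s)) \<and> deriv F differentiable (at a)"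

definition second_variation ::
    "((real \<Rightarrow> complex) \<Rightarrow> real) \<Rightarrow> (real \<Rightarrow> complex) \<Rightarrow> (real \<Rightarrow> complex) \<Rightarrow> real" where
  "second_variation J \<psi> h = deriv (deriv (\<lambda>s. J (perturb \<psi> h s))) 0"

end

theory Submission imports Defs begin

text \<open>
  Along \<open>s \<mapsto> u\<^sub>0 + s (u + i v)\<close> the functional \<open>\<Lambda>\<close> is a polynomial in \<open>s\<close>, so the second variation
  is twice the integral of the coefficient of \<open>s\<^sup>2\<close> in its density. Write \<open>w = tanh (x / \<surd>2)\<close>, so that
  \<open>w' = (1 - w\<^sup>2) / \<surd>2\<close>. Up to an exact derivative, that coefficient is
  \<open>(v'' + (1 - w\<^sup>2) v)\<^sup>2 + (w v' - w' v)\<^sup>2 + (y')\<^sup>2 + y\<^sup>2\<close> with \<open>y = u' + \<surd>2 w u\<close>.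
  The four squares vanish on the phase mode \<open>v = w\<close> and on the translation mode \<open>u = w'\<close>, and the
  exact derivative integrates to zero because \<open>u\<close> and \<open>v\<close> have bounded \<open>C\<^sup>1\<close> representatives with
  absolutely continuous derivatives.
\<close>

section \<open>Smooth bump functions and the fundamental lemma\<close>

text \<open>The squares come from linearising the profile equation
  \<open>w'' + w (1 - w^2) = 0\<close>. With \<open>L_- = -d^2/dx^2 - (1 - w^2)\<close> and
  \<open>L_+ = -d^2/dx^2 + 3 w^2 - 1\<close>, the first square is \<open>(L_- v)^2\<close> and the
  second is the squared Wronskian of \<open>v\<close> with the null mode \<open>w\<close> of
  \<open>L_-\<close>. Since \<open>sqrt 2 * w' = 1 - w^2\<close>, the operator \<open>L_+\<close> is
  the adjoint of \<open>A = d/dx + sqrt 2 * w\<close> composed with \<open>A\<close>; thus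
  \<open>y = A u\<close>, and the integral of \<open>y^2\<close> is the quadratic form of
  \<open>L_+\<close>. Two obstacles shape the proof. The functions \<open>u\<close>,
  \<open>v\<close> are known only up to null sets and \<open>weak_deriv\<close> is an arbitrary
  choice, so no sum or product rule holds for it pointwise; such rules are proved instead for
  primitives, that is, locally absolutely continuous functions with a density, and passing between
  the two notions needs concrete smooth bumps. Moreover the kink does not decay: \<open>1\<close>
  and \<open>|psi|^2\<close> are not integrable separately, and \<open>1 - |psi|^2\<close> has to be
  carried as one object.\<close>

primrec times_differentiable :: "nat \<Rightarrow> (real \<Rightarrow> real) \<Rightarrow> bool" where
  "times_differentiable 0 f \<longleftrightarrow> True"
| "times_differentiable (Suc n) f \<longleftrightarrow>
     (\<exists>f'. (\<forall>x. (f has_real_derivative f' x) (at x)) \<and> times_differentiable n f')"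

lemma times_differentiable_SucD: "times_differentiable (Suc n) f \<Longrightarrow> times_differentiable n f"
proof (induction n arbitrary: f)
  case (Suc n)
  then obtain f' where f': "\<forall>x. (f has_real_derivative f' x) (at x)" "times_differentiable (Suc n) f'"
    by (metis times_differentiable.simps(2))
  with Suc.IH show ?case by auto
qed simp

lemma times_differentiable_add:
  "times_differentiable n f \<Longrightarrow> times_differentiable n g \<Longrightarrow> times_differentiable n (\<lambda>x. f x + g x)"
proof (induction n arbitrary: f g)
  case (Suc n)
  then obtain f' g' where
    "\<forall>x. (f has_real_derivative f' x) (at x)" "times_differentiable n f'"
    "\<forall>x. (g has_real_derivative g' x) (at x)" "times_differentiable n g'"
    by auto
  with Suc.IH[of f' g'] show ?case
    by (auto intro!: exI[of _ "\<lambda>x. f' x + g' x"] derivative_eq_intros)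
qed simp

lemma times_differentiable_mult:
  "times_differentiable n f \<Longrightarrow> times_differentiable n g \<Longrightarrow> times_differentiable n (\<lambda>x. f x * g x)"
proof (induction n arbitrary: f g)
  case (Suc n)
  then obtain f' g' where
    "\<forall>x. (f has_real_derivative f' x) (at x)" "times_differentiable n f'"
    "\<forall>x. (g has_real_derivative g' x) (at x)" "times_differentiable n g'"
    by auto
  moreover have "times_differentiable n f" "times_differentiable n g"
    using Suc.prems by (simp_all only: times_differentiable_SucD)
  ultimately show ?case using Suc.IH[of f' g] Suc.IH[of f g']
    by (auto intro!: exI[of _ "\<lambda>x. f' x * g x + f x * g' x"] derivative_eq_intros
          times_differentiable_add)
qed simp

lemma times_differentiable_const: "times_differentiable n (\<lambda>_. c)"
  by (induction n arbitrary: c) (auto intro!: exI[of _ "\<lambda>_. 0"])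

lemma times_differentiable_affine:
  "times_differentiable n f \<Longrightarrow> times_differentiable n (\<lambda>x. f (c * x + d))"
proof (induction n arbitrary: f)
  case (Suc n)
  then obtain f' where f': "\<And>x. (f has_real_derivative f' x) (at x)" "times_differentiable n f'"
    by auto
  have "((\<lambda>x. f (c * x + d)) has_real_derivative c * f' (c * x + d)) (at x)" for x
  proof -
    have "((\<lambda>x. c * x + d) has_real_derivative c) (at x)"
      by (auto intro!: derivative_eq_intros)
    from DERIV_chain2[OF f'(1) this] show ?thesis by (simp add: mult.commute)
  qed
  with Suc.IH[OF f'(2)] show ?case
    by (auto intro!: exI[of _ "\<lambda>x. c * f' (c * x + d)"] times_differentiable_mult
          times_differentiable_const)
qed simp

text \<open>The recursive predicate lets the derivative at each level be any witness, which suits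
  induction over sums and products; uniqueness of derivatives makes every witness equal to
  \<open>deriv f\<close>. The quantifier over all orders matters: for a single \<open>n\<close> the
  right side asks for one derivative more than the left.\<close>

lemma times_differentiable_all_iff:
  "(\<forall>n. times_differentiable n f) \<longleftrightarrow> (\<forall>n x. (deriv ^^ n) f differentiable (at x))"
proof (intro iffI allI)
  fix n x assume "\<forall>n. times_differentiable n f"
  then show "(deriv ^^ n) f differentiable (at x)"
  proof (induction n arbitrary: f)
    case 0
    then have "times_differentiable (Suc 0) f" by blast
    then show ?case by (auto simp: real_differentiable_def)
  next
    case (Suc n)
    have "times_differentiable n (deriv f)" for n
    proof -
      have "times_differentiable (Suc n) f" using Suc.prems by blast
      then obtain f' where "\<And>x. (f has_real_derivative f' x) (at x)" "times_differentiable n f'"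
        by auto
      moreover from this have "deriv f = f'" by (auto intro: DERIV_imp_deriv)
      ultimately show ?thesis by simp
    qed
    then show ?case using Suc.IH[of "deriv f"] by (simp add: funpow_swap1)
  qed
next
  fix n assume "\<forall>n x. (deriv ^^ n) f differentiable (at x)"
  then show "times_differentiable n f"
  proof (induction n arbitrary: f)
    case (Suc n)
    have "\<forall>m x. (deriv ^^ m) (deriv f) differentiable (at x)"
      using Suc.prems by (metis comp_apply funpow_Suc_right)
    moreover have "(f has_real_derivative deriv f x) (at x)" for x
      using Suc.prems[rule_format, of 0 x] by (simp add: DERIV_deriv_iff_real_differentiable)
    ultimately show ?case using Suc.IH[of "deriv f"] by auto
  qed simp
qed

section \<open>Elementary properties of test functions\<close>

lemma test_functionI:
  assumes "\<And>n. times_differentiable n \<phi>" and "\<And>x. \<bar>x\<bar> > M \<Longrightarrow> \<phi> x = 0"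
  shows "test_function \<phi>"
proof -
  have "{x. \<phi> x \<noteq> 0} \<subseteq> {-M..M}" using assms(2) by force
  then have "bounded {x. \<phi> x \<noteq> 0}" using bounded_subset bounded_closed_interval by blast
  then show ?thesis using assms(1) times_differentiable_all_iff[of \<phi>]
    by (auto simp: test_function_def compact_closure)
qed

lemma test_function_DERIV: "test_function \<phi> \<Longrightarrow> (\<phi> has_real_derivative deriv \<phi> x) (at x)"
  unfolding test_function_def
  by (metis DERIV_deriv_iff_real_differentiable funpow_0)

lemma test_function_support:
  assumes "test_function \<phi>"
  obtains M where "M > 0" "\<And>x. \<bar>x\<bar> > M \<Longrightarrow> \<phi> x = 0" "\<And>x. \<bar>x\<bar> > M \<Longrightarrow> deriv \<phi> x = 0"
proof -
  have "bounded {x. \<phi> x \<noteq> 0}" using assms by (simp add: test_function_def)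
  then obtain M where M: "M > 0" "\<And>x. \<phi> x \<noteq> 0 \<Longrightarrow> \<bar>x\<bar> \<le> M"
    by (auto simp: bounded_pos)
  have "deriv \<phi> x = 0" if x: "\<bar>x\<bar> > M" for x
  proof (rule DERIV_imp_deriv)
    have op: "open {x::real. \<bar>x\<bar> > M}" by (intro open_Collect_less continuous_intros)
    have "((\<lambda>_. 0::real) has_real_derivative 0) (at x)" by simp
    then show "(\<phi> has_real_derivative 0) (at x)"
      by (rule has_field_derivative_transform_within_open[OF _ op]) (use x M in force)+
  qed
  with M that show thesis by (meson not_le)
qed

lemma test_function_deriv:
  assumes "test_function \<phi>" shows "test_function (deriv \<phi>)"
proof -
  obtain M where M: "\<And>x. \<bar>x\<bar> > M \<Longrightarrow> deriv \<phi> x = 0"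
    using test_function_support[OF assms] by metis
  have "(deriv ^^ n) (deriv \<phi>) differentiable (at x)" for n x
    using assms unfolding test_function_def by (metis comp_apply funpow_Suc_right)
  then show ?thesis using times_differentiable_all_iff M by (intro test_functionI) blast+
qed

lemma test_function_continuous_on: "test_function \<phi> \<Longrightarrow> continuous_on A \<phi>"
  by (meson DERIV_isCont continuous_at_imp_continuous_on test_function_DERIV)

lemma test_function_bounded:
  assumes "test_function \<phi>" obtains B where "\<And>x. \<bar>\<phi> x\<bar> \<le> B"
proof -
  obtain M where M: "M > 0" "\<And>x. \<bar>x\<bar> > M \<Longrightarrow> \<phi> x = 0"
    using test_function_support[OF assms] by metis
  have "compact (\<phi> ` {-M..M})"
    by (intro compact_continuous_image test_function_continuous_on assms) auto
  then obtain B where B: "\<And>x. x \<in> {-M..M} \<Longrightarrow> \<bar>\<phi> x\<bar> \<le> B"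
    by (force dest!: compact_imp_bounded simp: bounded_iff)
  have "\<bar>\<phi> x\<bar> \<le> B" for x
  proof (cases "\<bar>x\<bar> > M")
    case True
    have "0 \<le> B" using B[of 0] M by force
    then show ?thesis using True M by simp
  next
    case False
    then have "x \<in> {-M..M}" by auto
    then show ?thesis by (rule B)
  qed
  with that show thesis by blast
qed

lemma test_function_linear:
  assumes "test_function \<phi>" "test_function \<eta>"
  shows "test_function (\<lambda>x. \<phi> x + c * \<eta> x)"
proof -
  obtain M N where "\<And>x. \<bar>x\<bar> > M \<Longrightarrow> \<phi> x = 0" "\<And>x. \<bar>x\<bar> > N \<Longrightarrow> \<eta> x = 0"
    using test_function_support[OF assms(1)] test_function_support[OF assms(2)] by metis
  moreover have "times_differentiable n \<phi>" "times_differentiable n \<eta>" for n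
    using assms times_differentiable_all_iff unfolding test_function_def by blast+
  ultimately show ?thesis
    by (intro test_functionI[of _ "max M N"] times_differentiable_add times_differentiable_mult
          times_differentiable_const) auto
qed

section \<open>The flat function \<open>exp (- 1 / x)\<close> and bumps built from it\<close>

lemma tendsto_poly_mult_exp_minus: "((\<lambda>t::real. poly p t * exp (-t)) \<longlongrightarrow> 0) at_top"
proof -
  have "((\<lambda>t::real. \<Sum>i\<le>degree p. coeff p i * (t ^ i / exp t)) \<longlongrightarrow> (\<Sum>i\<le>degree p. coeff p i * 0)) at_top"
    by (intro tendsto_intros tendsto_power_div_exp_0)
  moreover have "(\<Sum>i\<le>degree p. coeff p i * (t ^ i / exp t)) = poly p t * exp (-t)" for t :: real
    by (simp add: poly_altdef sum_distrib_left exp_minus divide_inverse mult_ac)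
  ultimately show ?thesis by simp
qed

text \<open>The polynomial parameter makes the family closed under differentiation, so smoothness of
  all members is a single induction on the order. The classical flat function is the case
  \<open>p = 1\<close>.\<close>

definition flat_exp :: "real poly \<Rightarrow> real \<Rightarrow> real" where
  "flat_exp p x = (if x > 0 then poly p (1 / x) * exp (- (1 / x)) else 0)"

text \<open>With \<open>t = 1 / x\<close> one has \<open>dt/dx = - t^2\<close>, hence
  \<open>p(t) exp(-t)\<close> has derivative \<open>t^2 (p(t) - p'(t)) exp(-t)\<close>; the factor
  \<open>[:0, 0, 1:]\<close> is \<open>t^2\<close>. Only the origin needs a limit.\<close>

lemma flat_exp_DERIV:
  "(flat_exp p has_real_derivative flat_exp ([:0, 0, 1:] * (p - pderiv p)) x) (at x)"
proof -
  consider "x > 0" | "x < 0" | "x = 0" by linarith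
  then show ?thesis
  proof cases
    case 1
    have "((\<lambda>x. poly p (1 / x) * exp (- (1 / x))) has_real_derivative
            flat_exp ([:0, 0, 1:] * (p - pderiv p)) x) (at x)"
      using 1 unfolding flat_exp_def
      by (auto intro!: derivative_eq_intros DERIV_chain'[OF _ poly_DERIV]
           simp: field_simps power2_eq_square)
    then show ?thesis
      by (rule has_field_derivative_transform_within_open[where S="{0<..}"])
         (use 1 in \<open>auto simp: flat_exp_def\<close>)
  next
    case 2
    have "((\<lambda>_. 0) has_real_derivative flat_exp ([:0, 0, 1:] * (p - pderiv p)) x) (at x)"
      using 2 by (simp add: flat_exp_def)
    then show ?thesis
      by (rule has_field_derivative_transform_within_open[where S="{..<0}"])
         (use 2 in \<open>auto simp: flat_exp_def\<close>)
  next
    case 3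
    have "((\<lambda>y. flat_exp p y / y) \<longlongrightarrow> 0) (at 0)"
    proof (rule filterlim_split_at)
      show "((\<lambda>y. flat_exp p y / y) \<longlongrightarrow> 0) (at_left 0)"
        by (rule tendsto_eventually)
           (auto simp: flat_exp_def eventually_at_filter)
      \<comment> \<open>Dividing the value by \<open>y\<close> multiplies by
        \<open>t = 1 / y\<close>, so the difference quotient is again a polynomial in
        \<open>t\<close> times \<open>exp(-t)\<close>, now with \<open>t\<close> tending to
        infinity.\<close>
      have "((\<lambda>y. poly ([:0, 1:] * p) (inverse y) * exp (- inverse y)) \<longlongrightarrow> 0) (at_right 0)"
        by (rule filterlim_compose[OF tendsto_poly_mult_exp_minus filterlim_inverse_at_top_right])
      moreover have "\<forall>\<^sub>F y in at_right 0. poly ([:0, 1:] * p) (inverse y) * exp (- inverse y) = flat_exp p y / y"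
        by (auto simp: flat_exp_def eventually_at_filter field_simps)
      ultimately show "((\<lambda>y. flat_exp p y / y) \<longlongrightarrow> 0) (at_right 0)"
        by (rule Lim_transform_eventually)
    qed
    then show ?thesis using 3 by (simp add: has_field_derivative_iff flat_exp_def)
  qed
qed

lemma times_differentiable_flat_exp: "times_differentiable n (flat_exp p)"
  by (induction n arbitrary: p) (use flat_exp_DERIV in auto)

text \<open>For fixed positive \<open>n\<close> and \<open>a < b\<close> this is a bump on the open
  interval. Increasing \<open>n\<close> steepens both flanks until the indicator of the interval is
  reached pointwise, so indicators are approximated by dominated convergence and no mollification is
  required.\<close>

definition plateau :: "nat \<Rightarrow> real \<Rightarrow> real \<Rightarrow> real \<Rightarrow> real" where
  "plateau n a b x = flat_exp 1 (real n * (x - a)) * flat_exp 1 (real n * (b - x))"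

lemma test_function_plateau: "test_function (plateau n a b)"
proof (rule test_functionI)
  show "times_differentiable k (plateau n a b)" for k
  proof -
    have "times_differentiable k (\<lambda>x. flat_exp 1 (real n * x + (- real n * a)) * flat_exp 1 (- real n * x + real n * b))"
      by (intro times_differentiable_mult times_differentiable_affine times_differentiable_flat_exp)
    then show ?thesis by (simp add: plateau_def[abs_def] algebra_simps)
  qed
  show "plateau n a b x = 0" if "\<bar>x\<bar> > max \<bar>a\<bar> \<bar>b\<bar>" for x
    using that by (auto simp: plateau_def flat_exp_def zero_less_mult_iff)
qed

lemma flat_exp_1_bounds: "0 \<le> flat_exp 1 x" "flat_exp 1 x \<le> 1"
  by (auto simp: flat_exp_def)

lemma plateau_bounds: "\<bar>plateau n a b x\<bar> \<le> indicator {a..b} x"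
  using flat_exp_1_bounds[of "real n * (x - a)"] flat_exp_1_bounds[of "real n * (b - x)"]
  by (auto simp: plateau_def indicator_def abs_mult mult_le_one)
     (auto simp: flat_exp_def zero_less_mult_iff)

lemma plateau_tendsto: "(\<lambda>n. plateau n a b x) \<longlonglongrightarrow> indicator {a<..<b} x"
proof (cases "a < x \<and> x < b")
  case True
  have 1: "(\<lambda>n. flat_exp 1 (real n * c)) \<longlonglongrightarrow> 1" if "c > 0" for c
  proof -
    have "(\<lambda>n. exp (- ((1/c) * (1 / real n)))) \<longlonglongrightarrow> exp (- ((1/c) * 0))"
      by (intro tendsto_intros lim_1_over_n)
    moreover have "\<forall>\<^sub>F n in sequentially. exp (- ((1/c) * (1 / real n))) = flat_exp 1 (real n * c)"
      using eventually_gt_at_top[of "0::nat"]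
      by (rule eventually_mono) (use that in \<open>auto simp: flat_exp_def field_simps\<close>)
    ultimately show ?thesis by (auto intro: Lim_transform_eventually)
  qed
  have "(\<lambda>n. plateau n a b x) \<longlonglongrightarrow> 1 * 1"
    unfolding plateau_def using True by (intro tendsto_mult 1) auto
  with True show ?thesis by simp
next
  case False
  then have "plateau n a b x = 0" for n by (auto simp: plateau_def flat_exp_def zero_less_mult_iff)
  moreover have "indicator {a<..<b} x = (0::real)" using False by (auto simp: indicator_def)
  ultimately show ?thesis by simp
qed

text \<open>Supplies the nonzero denominator for normalising a bump. A zero integral would make the
  nonnegative bump vanish almost everywhere, although it is nonzero on an interval of positive
  length.\<close>

lemma plateau_integral_pos:
  assumes "a < b" shows "integral\<^sup>L lborel (plateau 1 a b) > 0"
proof -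
  have cont: "continuous_on UNIV (plateau 1 a b)"
    by (rule test_function_continuous_on[OF test_function_plateau])
  have [measurable]: "plateau 1 a b \<in> borel_measurable borel"
    using cont by (rule borel_measurable_continuous_onI)
  have nn: "0 \<le> plateau 1 a b x" for x
    by (simp add: plateau_def flat_exp_1_bounds)
  have int: "integrable lborel (plateau 1 a b)"
    by (rule Bochner_Integration.integrable_bound[where f="indicator {a..b} :: real \<Rightarrow> real"])
       (use plateau_bounds[of 1 a b] in \<open>auto simp del: One_nat_def intro!: integrable_real_indicator emeasure_lborel_Icc_eq[THEN ord_eq_less_trans]\<close>)
  show ?thesis
  proof (rule ccontr)
    assume "\<not> ?thesis"
    then have "integral\<^sup>L lborel (plateau 1 a b) = 0"
      using Bochner_Integration.integral_nonneg[of lborel "plateau 1 a b", OF nn] by linarith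
    then have *: "AE x in lborel. plateau 1 a b x = 0"
      using integral_nonneg_eq_0_iff_AE[OF int] nn by simp
    have ne: "plateau 1 a b x \<noteq> 0" if "x \<in> {a<..<b}" for x
      using that by (auto simp: plateau_def flat_exp_def)
    from * have "AE x in lborel. x \<notin> {a<..<b}" by (rule AE_mp) (use ne in blast)
    then have "{a<..<b} \<in> null_sets lborel"
      by (subst (asm) AE_iff_null_sets[symmetric]) auto
    with assms show False by (simp add: null_sets_def)
  qed
qed


text \<open>The positive and negative parts are densities of two finite measures that agree on all
  half-lines. Half-lines determine a finite Borel measure, and a measure determines its density
  almost everywhere.\<close>

lemma AE_zero_if_tail_integrals_zero:
  fixes h :: "real \<Rightarrow> real"
  assumes int: "integrable lborel h" and zero: "\<And>x. (LINT t:{x<..}|lborel. h t) = 0"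
  shows "AE x in lborel. h x = 0"
proof -
  have [measurable]: "h \<in> borel_measurable borel"
    using borel_measurable_integrable[OF int] by simp
  define p n where "p x = max (h x) 0" and "n x = max (- h x) 0" for x
  have pn: "h x = p x - n x" "p x \<ge> 0" "n x \<ge> 0" for x
    by (auto simp: p_def n_def)
  have ip: "integrable lborel p" "integrable lborel n"
    unfolding p_def n_def using int by auto
  have [measurable]: "p \<in> borel_measurable borel" "n \<in> borel_measurable borel"
    using ip[THEN borel_measurable_integrable] by simp_all
  have em: "emeasure (density lborel (\<lambda>x. ennreal (q x))) {x<..} = ennreal (LINT t:{x<..}|lborel. q t)"
    if "integrable lborel q" "\<And>x. q x \<ge> 0" for q :: "real \<Rightarrow> real" and x
  proof -
    have [measurable]: "q \<in> borel_measurable borel"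
      using that(1)[THEN borel_measurable_integrable] by simp
    have "emeasure (density lborel (\<lambda>x. ennreal (q x))) {x<..}
        = (\<integral>\<^sup>+t. ennreal (indicator {x<..} t * q t) \<partial>lborel)"
      by (subst emeasure_density) (auto intro!: nn_integral_cong split: split_indicator)
    also have "\<dots> = ennreal (\<integral>t. indicator {x<..} t * q t \<partial>lborel)"
      using that by (intro nn_integral_eq_integral integrable_real_mult_indicator) (auto simp: mult.commute intro!: integrable_real_mult_indicator)
    finally show ?thesis by (simp add: set_lebesgue_integral_def)
  qed
  have eq: "(LINT t:{x<..}|lborel. p t) = (LINT t:{x<..}|lborel. n t)" for x
  proof -
    have "set_integrable lborel {x<..} p" "set_integrable lborel {x<..} n"
      unfolding set_integrable_def using ip by (auto intro!: integrable_mult_indicator simp del: real_scaleR_def)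
    then have "(LINT t:{x<..}|lborel. p t - n t) = (LINT t:{x<..}|lborel. p t) - (LINT t:{x<..}|lborel. n t)"
      by (rule set_integral_diff)
    with zero[of x] show ?thesis by (simp add: pn(1)[symmetric])
  qed
  have "density lborel (\<lambda>x. ennreal (p x)) = density lborel (\<lambda>x. ennreal (n x))"
    by (rule measure_eqI_lessThan) (auto simp: em[OF ip(1) pn(2)] em[OF ip(2) pn(3)] eq)
  then have "AE x in lborel. ennreal (p x) = ennreal (n x)"
    by (subst (asm) sigma_finite_measure.density_unique_iff[OF lborel.sigma_finite_measure_axioms]) auto
  then show ?thesis
    by (rule AE_mp) (auto simp: p_def n_def max_def split: if_splits)
qed

lemma locally_integrable_test_function_mult:
  fixes f :: "real \<Rightarrow> 'a::euclidean_space"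
  assumes "locally_integrable f" "test_function \<phi>"
  shows "integrable lborel (\<lambda>x. \<phi> x *\<^sub>R f x)"
proof -
  obtain M where M: "\<And>x. \<bar>x\<bar> > M \<Longrightarrow> \<phi> x = 0"
    using test_function_support[OF assms(2)] by metis
  obtain B where B: "\<And>x. \<bar>\<phi> x\<bar> \<le> B" using test_function_bounded[OF assms(2)] by metis
  have [measurable]: "f \<in> borel_measurable borel" using assms(1) by (simp add: locally_integrable_def)
  have [measurable]: "\<phi> \<in> borel_measurable borel"
    using test_function_continuous_on[OF assms(2)] by (rule borel_measurable_continuous_onI)
  have "integrable lborel (\<lambda>x. B *\<^sub>R (indicator {-M..M} x *\<^sub>R f x))"
    using assms(1) unfolding locally_integrable_def set_integrable_def
    by (intro integrable_scaleR_right) blast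
  then show ?thesis
  proof (rule Bochner_Integration.integrable_bound)
    show "AE x in lborel. norm (\<phi> x *\<^sub>R f x) \<le> norm (B *\<^sub>R (indicator {-M..M} x *\<^sub>R f x))"
    proof (rule AE_I2)
      fix x
      have "\<bar>\<phi> x\<bar> \<le> \<bar>B\<bar>" using B[of x] by linarith
      then show "norm (\<phi> x *\<^sub>R f x) \<le> norm (B *\<^sub>R (indicator {-M..M} x *\<^sub>R f x))"
        using M[of x] by (auto simp: indicator_def intro!: mult_right_mono)
    qed
  qed simp
qed

text \<open>The fundamental lemma of the calculus of variations. Plateaus are test functions and
  converge boundedly to indicators, so the integral of \<open>g\<close> over every bounded open
  interval vanishes; the tail criterion then applies to truncations of \<open>g\<close>.\<close>

lemma AE_zero_if_test_integrals_zero: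
  fixes g :: "real \<Rightarrow> real"
  assumes g: "locally_integrable g"
    and zero: "\<And>\<phi>. test_function \<phi> \<Longrightarrow> (\<integral>x. \<phi> x * g x \<partial>lborel) = 0"
  shows "AE x in lborel. g x = 0"
proof -
  have [measurable]: "g \<in> borel_measurable borel" using g by (simp add: locally_integrable_def)
  have open_zero: "(\<integral>x. indicator {a<..<b} x * g x \<partial>lborel) = 0" for a b
  proof -
    have "(\<lambda>n. \<integral>x. plateau n a b x * g x \<partial>lborel) \<longlonglongrightarrow> (\<integral>x. indicator {a<..<b} x * g x \<partial>lborel)"
    proof (rule integral_dominated_convergence[where w="\<lambda>x. indicator {a..b} x * \<bar>g x\<bar>"])
      have "(\<lambda>x. plateau n a b x) \<in> borel_measurable borel" for n
        using test_function_continuous_on[OF test_function_plateau]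
        by (rule borel_measurable_continuous_onI)
      then show "(\<lambda>x. plateau n a b x * g x) \<in> borel_measurable lborel" for n by simp
      show "integrable lborel (\<lambda>x. indicator {a..b} x * \<bar>g x\<bar>)"
        using g set_integrable_abs[of lborel "{a..b}" g]
        by (simp add: locally_integrable_def set_integrable_def)
      show "AE x in lborel. norm (plateau n a b x * g x) \<le> indicator {a..b} x * \<bar>g x\<bar>" for n
        using plateau_bounds by (auto simp: abs_mult intro!: mult_right_mono)
      show "AE x in lborel. (\<lambda>n. plateau n a b x * g x) \<longlonglongrightarrow> indicator {a<..<b} x * g x"
        by (intro AE_I2 tendsto_mult plateau_tendsto tendsto_const)
    qed simp
    then show ?thesis
      using zero[OF test_function_plateau] by (simp add: LIMSEQ_const_iff)
  qed
  \<comment> \<open>\<open>g\<close> need not be globally integrable, so it is cut off to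
    \<open>(-n, n)\<close>. A tail integral of the truncation is the integral of \<open>g\<close>
    over one open interval, possibly empty.\<close>
  have "AE x in lborel. indicator {- real n<..<real n} x * g x = 0" for n
  proof (rule AE_zero_if_tail_integrals_zero)
    have "set_integrable lborel {- real n<..<real n} g"
      by (rule set_integrable_subset[where A="{- real n..real n}"])
         (use g in \<open>auto simp: locally_integrable_def\<close>)
    then show "integrable lborel (\<lambda>x. indicator {- real n<..<real n} x * g x)"
      by (simp add: set_integrable_def)
    show "(LINT t:{x<..}|lborel. indicator {- real n<..<real n} t * g t) = 0" for x
    proof -
      have "(LINT t:{x<..}|lborel. indicator {- real n<..<real n} t * g t)
          = (\<integral>t. indicator {max x (- real n)<..<real n} t * g t \<partial>lborel)"
        unfolding set_lebesgue_integral_def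
        by (intro Bochner_Integration.integral_cong) (auto split: split_indicator)
      then show ?thesis by (simp add: open_zero)
    qed
  qed
  then have "AE x in lborel. \<forall>n. indicator {- real n<..<real n} x * g x = 0"
    by (subst AE_all_countable) blast
  then show ?thesis
  proof (rule AE_mp, intro AE_I2 impI)
    fix x assume *: "\<forall>n. indicator {- real n<..<real n} x * g x = 0"
    obtain n where "\<bar>x\<bar> < real n" using reals_Archimedean2 by blast
    with *[rule_format, of n] show "g x = 0" by (auto simp: indicator_def)
  qed
qed

section \<open>Indefinite integrals\<close>

text \<open>Local absolute continuity, stated by the integral identity alone. No pointwise
  derivative occurs, so the density may be changed on null sets while \<open>F\<close> is a genuine
  continuous function.\<close>

definition is_primitive :: "(real \<Rightarrow> real) \<Rightarrow> (real \<Rightarrow> real) \<Rightarrow> bool" where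
  "is_primitive F f \<longleftrightarrow>
     locally_integrable f \<and> (\<forall>a b. a \<le> b \<longrightarrow> (LINT x:{a..b}|lborel. f x) = F b - F a)"

lemma locally_integrable_add:
  "locally_integrable f \<Longrightarrow> locally_integrable g \<Longrightarrow> locally_integrable (\<lambda>x. f x + g x)"
  by (auto simp: locally_integrable_def)

lemma locally_integrable_continuous_mult:
  fixes f G :: "real \<Rightarrow> real"
  assumes f: "locally_integrable f" and G: "continuous_on UNIV G"
  shows "locally_integrable (\<lambda>x. G x * f x)"
  unfolding locally_integrable_def
proof safe
  have [measurable]: "f \<in> borel_measurable borel" "G \<in> borel_measurable borel"
    using f G by (auto simp: locally_integrable_def intro: borel_measurable_continuous_onI)
  show "(\<lambda>x. G x * f x) \<in> borel_measurable lborel" by simp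
  fix a b :: real
  have "compact (G ` {a..b})"
    by (intro compact_continuous_image continuous_on_subset[OF G]) auto
  then obtain B where B: "\<And>x. x \<in> {a..b} \<Longrightarrow> \<bar>G x\<bar> \<le> B"
    by (force dest!: compact_imp_bounded simp: bounded_iff)
  have "set_integrable lborel {a..b} (\<lambda>x. B * f x)"
    using f by (simp add: locally_integrable_def)
  then show "set_integrable lborel {a..b} (\<lambda>x. G x * f x)"
  proof (rule set_integrable_bound)
    show "AE x in lborel. x \<in> {a..b} \<longrightarrow> norm (G x * f x) \<le> norm (B * f x)"
    proof (intro AE_I2 impI)
      fix x assume "x \<in> {a..b}"
      then have "\<bar>G x\<bar> \<le> \<bar>B\<bar>" using B[of x] by linarith
      then show "norm (G x * f x) \<le> norm (B * f x)" by (simp add: abs_mult mult_right_mono)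
    qed
  qed (simp add: set_borel_measurable_def)
qed

lemma locally_integrable_continuous:
  fixes F :: "real \<Rightarrow> real"
  assumes "continuous_on UNIV F" shows "locally_integrable F"
  unfolding locally_integrable_def
  using assms by (auto intro!: borel_measurable_continuous_onI borel_integrable_atLeastAtMost'
      continuous_on_subset[OF assms])

lemma is_primitive_continuous:
  assumes "is_primitive F f" shows "continuous_on A F"
proof -
  have "isCont F x" for x
  proof -
    obtain N where N: "\<bar>x\<bar> < N" using gt_ex by blast
    have int: "set_integrable lborel {a..b} f" for a b
      using assms by (simp add: is_primitive_def locally_integrable_def)
    have "continuous_on {-N..N} (\<lambda>t. F (-N) + integral {-N..t} f)"
      by (intro continuous_intros indefinite_integral_continuous_1 set_borel_integral_eq_integral(1) int)
    moreover have "F (-N) + integral {-N..t} f = F t" if "t \<in> {-N..N}" for t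
      using assms that set_borel_integral_eq_integral(2)[OF int, of "-N" t]
      by (simp add: is_primitive_def)
    ultimately have "continuous_on {-N..N} F" by (blast intro: continuous_on_eq)
    then show ?thesis by (rule continuous_on_interior) (use N in auto)
  qed
  then show ?thesis by (simp add: continuous_at_imp_continuous_on)
qed

lemma is_primitive_DERIV:
  assumes "is_primitive F f" and f: "continuous_on UNIV f"
  shows "(F has_real_derivative f x) (at x)"
proof -
  define a b where "a = x - 1" and "b = x + 1"
  have int: "set_integrable lborel {a..b} f" for a b
    using assms by (simp add: is_primitive_def locally_integrable_def)
  have "((\<lambda>t. integral {a..t} f) has_real_derivative f x) (at x within {a..b})"
    by (rule integral_has_real_derivative) (auto simp: a_def b_def intro: continuous_on_subset[OF f])
  then have "((\<lambda>t. integral {a..t} f) has_real_derivative f x) (at x)"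
    by (simp add: at_within_Icc_at a_def b_def)
  then have "((\<lambda>t. F a + integral {a..t} f) has_real_derivative f x) (at x)"
    by (auto intro!: derivative_eq_intros)
  then show ?thesis
  proof (rule has_field_derivative_transform_within_open[where S="{a<..<b}"])
    show "F a + integral {a..t} f = F t" if "t \<in> {a<..<b}" for t
      using assms that set_borel_integral_eq_integral(2)[OF int, of a t]
      by (simp add: is_primitive_def)
  qed (auto simp: a_def b_def)
qed

lemma DERIV_is_primitive:
  assumes "\<And>x. (F has_real_derivative f x) (at x)" and f: "continuous_on UNIV f"
  shows "is_primitive F f"
  unfolding is_primitive_def
proof safe
  show "locally_integrable f" using f by (rule locally_integrable_continuous)
  show "(LINT x:{a..b}|lborel. f x) = F b - F a" if "a \<le> b" for a b
    using integral_FTC_Icc_real[of a b F f] that assms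
    by (auto simp: set_lebesgue_integral_def mult.commute continuous_on_eq_continuous_at)
qed

text \<open>The signed interval integral makes one formula serve on both sides of the base point
  \<open>c\<close>.\<close>

lemma is_primitive_interval_integral:
  assumes "locally_integrable g"
  shows "is_primitive (\<lambda>x. LBINT t=ereal c..ereal x. g t) g"
  unfolding is_primitive_def
proof safe
  fix a b :: real assume "a \<le> b"
  have int: "interval_lebesgue_integrable lborel (ereal a) (ereal b) g" for a b
    using assms set_integrable_subset[of lborel "{a..b}" g "{a<..<b}"]
      set_integrable_subset[of lborel "{b..a}" g "{b<..<a}"]
    by (simp add: interval_lebesgue_integrable_def locally_integrable_def greaterThanLessThan_subseteq_atLeastAtMost_iff)
  have "(LBINT t=ereal c..ereal a. g t) + (LBINT t=ereal a..ereal b. g t) = (LBINT t=ereal c..ereal b. g t)"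
    by (rule interval_integral_sum) (use int in \<open>simp flip: ereal_min ereal_max\<close>)
  then show "(LINT x:{a..b}|lborel. g x) = (LBINT t=ereal c..ereal b. g t) - (LBINT t=ereal c..ereal a. g t)"
    using \<open>a \<le> b\<close> by (simp add: interval_integral_Icc)
qed (rule assms)

lemma is_primitive_add:
  "is_primitive F f \<Longrightarrow> is_primitive G g \<Longrightarrow> is_primitive (\<lambda>x. F x + G x) (\<lambda>x. f x + g x)"
  by (auto simp: is_primitive_def locally_integrable_def)

lemma is_primitive_cmult:
  "is_primitive F f \<Longrightarrow> is_primitive (\<lambda>x. c * F x) (\<lambda>x. c * f x)"
  by (auto simp: is_primitive_def locally_integrable_def simp flip: right_diff_distrib)

lemma is_primitive_cong_AE:
  assumes "is_primitive F f" and ae: "AE x in lborel. f x = g x"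
    and [measurable]: "g \<in> borel_measurable borel"
  shows "is_primitive F g"
proof -
  have [measurable]: "f \<in> borel_measurable borel"
    using assms by (auto simp: is_primitive_def locally_integrable_def)
  have "set_integrable lborel {a..b} f \<longleftrightarrow> set_integrable lborel {a..b} g" for a b
    unfolding set_integrable_def using ae by (intro integrable_cong_AE) auto
  moreover have "(LINT x:{a..b}|lborel. f x) = (LINT x:{a..b}|lborel. g x)" for a b
    unfolding set_lebesgue_integral_def using ae by (intro integral_cong_AE) auto
  ultimately show ?thesis using assms by (simp add: is_primitive_def locally_integrable_def)
qed

text \<open>The square \<open>{a..b} \<times> {a..b}\<close> is split along its diagonal, and Fubini is applied to
  \<open>f s * g t\<close> on the two triangles.\<close>

lemma is_primitive_mult:
  assumes F: "is_primitive F f" and G: "is_primitive G g"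
  shows "is_primitive (\<lambda>x. F x * G x) (\<lambda>x. f x * G x + F x * g x)"
  unfolding is_primitive_def
proof safe
  have lf: "locally_integrable f" and lg: "locally_integrable g"
    using F G by (auto simp: is_primitive_def)
  have [measurable]: "f \<in> borel_measurable borel" "g \<in> borel_measurable borel"
    using lf lg by (auto simp: locally_integrable_def)
  have l1: "locally_integrable (\<lambda>x. G x * f x)" and l2: "locally_integrable (\<lambda>x. F x * g x)"
    using lf lg is_primitive_continuous[OF F] is_primitive_continuous[OF G]
    by (auto intro: locally_integrable_continuous_mult)
  from locally_integrable_add[OF this]
  show "locally_integrable (\<lambda>x. f x * G x + F x * g x)" by (simp add: mult.commute)
  fix a b :: real assume "a \<le> b"
  define f0 g0 where "f0 s = indicator {a..b} s * f s" and "g0 s = indicator {a..b} s * g s" for s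
  have [measurable]: "f0 \<in> borel_measurable borel" "g0 \<in> borel_measurable borel"
    by (simp_all add: f0_def[abs_def] g0_def[abs_def])
  have int0: "integrable lborel f0" "integrable lborel g0"
    using lf lg by (auto simp: locally_integrable_def set_integrable_def f0_def[abs_def] g0_def[abs_def])
  have val0: "integral\<^sup>L lborel f0 = F b - F a" "integral\<^sup>L lborel g0 = G b - G a"
    using F G \<open>a \<le> b\<close> by (auto simp: is_primitive_def set_lebesgue_integral_def f0_def[abs_def] g0_def[abs_def])
  define k where "k = (\<lambda>(s, t). f0 s * g0 t)"
  define k1 where "k1 = (\<lambda>(s, t). if s \<le> t then f0 s * g0 t else 0)"
  define k2 where "k2 = (\<lambda>(s, t). if t < s then f0 s * g0 t else 0)"
  have km[measurable]: "k \<in> borel_measurable (lborel \<Otimes>\<^sub>M lborel)" "k1 \<in> borel_measurable (lborel \<Otimes>\<^sub>M lborel)"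
    "k2 \<in> borel_measurable (lborel \<Otimes>\<^sub>M lborel)"
    unfolding k_def k1_def k2_def case_prod_beta by measurable
  have ik: "integrable (lborel \<Otimes>\<^sub>M lborel) k"
    proof (rule lborel_pair.Fubini_integrable)
    show "integrable lborel (\<lambda>x. \<integral>y. norm (k (x, y)) \<partial>lborel)"
      using int0 by (simp add: k_def abs_mult)
    show "AE x in lborel. integrable lborel (\<lambda>y. k (x, y))"
      using int0 by (simp add: k_def)
  qed (rule km)
  have ik1: "integrable (lborel \<Otimes>\<^sub>M lborel) k1"
    by (rule Bochner_Integration.integrable_bound[OF ik]) (auto simp: k_def k1_def split: prod.split)
  have ik2: "integrable (lborel \<Otimes>\<^sub>M lborel) k2"
    by (rule Bochner_Integration.integrable_bound[OF ik]) (auto simp: k_def k2_def split: prod.split)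
  have "k z = k1 z + k2 z" for z by (cases z) (auto simp: k_def k1_def k2_def)
  then have "integral\<^sup>L (lborel \<Otimes>\<^sub>M lborel) k = integral\<^sup>L (lborel \<Otimes>\<^sub>M lborel) k1 + integral\<^sup>L (lborel \<Otimes>\<^sub>M lborel) k2"
    using ik1 ik2 by (simp cong: Bochner_Integration.integral_cong)
  moreover have "integral\<^sup>L (lborel \<Otimes>\<^sub>M lborel) k = (F b - F a) * (G b - G a)"
    by (subst lborel_pair.integral_fst'[OF ik, symmetric]) (simp add: k_def val0)
  moreover have "integral\<^sup>L (lborel \<Otimes>\<^sub>M lborel) k1 = (\<integral>t. g0 t * (F t - F a) \<partial>lborel)"
  proof -
    have "(\<integral>s. k1 (s, t) \<partial>lborel) = g0 t * (F t - F a)" for t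
    proof (cases "t \<in> {a..b}")
      case True
      then have "(\<integral>s. k1 (s, t) \<partial>lborel) = (\<integral>s. g0 t * (indicator {a..t} s * f s) \<partial>lborel)"
        by (intro Bochner_Integration.integral_cong) (auto simp: k1_def f0_def split: split_indicator)
      also have "\<dots> = g0 t * (F t - F a)"
        using F True by (simp add: is_primitive_def set_lebesgue_integral_def)
      finally show ?thesis .
    qed (simp add: k1_def g0_def cong: if_cong)
    then show ?thesis
      using lborel_pair.integral_snd[of "\<lambda>s t. k1 (s, t)"] ik1 by (simp add: case_prod_eta)
  qed
  moreover have "integral\<^sup>L (lborel \<Otimes>\<^sub>M lborel) k2 = (\<integral>s. f0 s * (G s - G a) \<partial>lborel)"
  proof -
    have "(\<integral>t. k2 (s, t) \<partial>lborel) = f0 s * (G s - G a)" for s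
    proof (cases "s \<in> {a..b}")
      case True
      have "(\<integral>t. k2 (s, t) \<partial>lborel) = (\<integral>t. f0 s * (indicator {a..s} t * g t) \<partial>lborel)"
      proof (rule integral_cong_AE)
        show "(\<lambda>t. k2 (s, t)) \<in> borel_measurable lborel"
          unfolding k2_def prod.case by measurable
        show "AE t in lborel. k2 (s, t) = f0 s * (indicator {a..s} t * g t)"
          \<comment> \<open>The triangle \<open>t < s\<close> omits the diagonal, whereas
            \<open>{a..s}\<close> contains its endpoint; the two integrands may differ only at
            \<open>t = s\<close>.\<close>
          using AE_lborel_singleton[of s]
        proof (rule eventually_mono)
          fix t assume "t \<noteq> s"
          with True show "k2 (s, t) = f0 s * (indicator {a..s} t * g t)"
            by (cases "t < s") (auto simp: k2_def g0_def indicator_def)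
        qed
      qed measurable
      also have "\<dots> = f0 s * (G s - G a)"
        using G True by (simp add: is_primitive_def set_lebesgue_integral_def)
      finally show ?thesis .
    qed (simp add: k2_def f0_def cong: if_cong)
    then show ?thesis
      using lborel_pair.integral_fst'[OF ik2] by simp
  qed
  \<comment> \<open>Both triangle integrals still contain the base values \<open>F a\<close> and
    \<open>G a\<close>. Expanding everything, these terms combine with the left side to leave
    \<open>F b * G b - F a * G a\<close>.\<close>
  ultimately have eq: "(F b - F a) * (G b - G a)
      = (\<integral>t. g0 t * (F t - F a) \<partial>lborel) + (\<integral>s. f0 s * (G s - G a) \<partial>lborel)"
    by simp
  have i1: "integrable lborel (\<lambda>s. f0 s * G s)" and i2: "integrable lborel (\<lambda>s. g0 s * F s)"
    using l1 l2 by (auto simp: locally_integrable_def set_integrable_def f0_def g0_def mult_ac)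
  have "(LINT x:{a..b}|lborel. f x * G x + F x * g x) = (\<integral>s. f0 s * G s + g0 s * F s \<partial>lborel)"
    unfolding set_lebesgue_integral_def
    by (intro Bochner_Integration.integral_cong) (auto simp: f0_def g0_def algebra_simps)
  also have "\<dots> = (\<integral>s. f0 s * G s \<partial>lborel) + (\<integral>s. g0 s * F s \<partial>lborel)"
    using i1 i2 by simp
  also have "\<dots> = F b * G b - F a * G a"
  proof -
    have "(\<integral>s. f0 s * (G s - G a) \<partial>lborel) = (\<integral>s. f0 s * G s \<partial>lborel) - G a * (F b - F a)"
      using i1 int0 by (simp add: right_diff_distrib val0) (simp add: algebra_simps)
    moreover have "(\<integral>s. g0 s * (F s - F a) \<partial>lborel) = (\<integral>s. g0 s * F s \<partial>lborel) - F a * (G b - G a)"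
      using i2 int0 by (simp add: right_diff_distrib val0) (simp add: algebra_simps)
    ultimately show ?thesis using eq by (simp add: algebra_simps)
  qed
  finally show "(LINT x:{a..b}|lborel. f x * G x + F x * g x) = F b * G b - F a * G a" .
qed

section \<open>Weak derivatives on the line\<close>

lemma test_function_is_primitive: "test_function \<phi> \<Longrightarrow> is_primitive \<phi> (deriv \<phi>)"
  by (intro DERIV_is_primitive test_function_DERIV test_function_continuous_on test_function_deriv)

text \<open>Integration by parts: the product rule for primitives, applied to \<open>\<phi>\<close>
  and \<open>F\<close> on an interval that covers the support, has no boundary terms.\<close>

lemma is_primitive_has_weak_deriv:
  assumes "is_primitive F f" shows "has_weak_deriv F f"
  unfolding has_weak_deriv_def
proof safe
  show lF: "locally_integrable F"
    by (intro locally_integrable_continuous is_primitive_continuous[OF assms])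
  show lf: "locally_integrable f" using assms by (simp add: is_primitive_def)
  fix \<phi> assume \<phi>: "test_function \<phi>"
  obtain M where M: "M > 0" "\<And>x. \<bar>x\<bar> > M \<Longrightarrow> \<phi> x = 0" "\<And>x. \<bar>x\<bar> > M \<Longrightarrow> deriv \<phi> x = 0"
    using test_function_support[OF \<phi>] by metis
  \<comment> \<open>The vanishing of \<open>\<phi>\<close> is known only for
    \<open>\<bar>x\<bar> > M\<close>, so the endpoints must lie strictly beyond
    \<open>M\<close>.\<close>
  define N where "N = M + 1"
  have N: "\<phi> N = 0" "\<phi> (-N) = 0" "-N \<le> N" using M(1) by (auto simp: N_def intro!: M)
  have supp: "deriv \<phi> x * F x + \<phi> x * f x = indicator {-N..N} x *\<^sub>R (deriv \<phi> x * F x + \<phi> x * f x)" for x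
    using M(2,3)[of x] by (cases "\<bar>x\<bar> > M") (auto simp: indicator_def N_def)
  have "(\<integral>x. deriv \<phi> x * F x + \<phi> x * f x \<partial>lborel) = (LINT x:{-N..N}|lborel. deriv \<phi> x * F x + \<phi> x * f x)"
    unfolding set_lebesgue_integral_def supp[symmetric] ..
  also have "\<dots> = 0"
    using is_primitive_mult[OF test_function_is_primitive[OF \<phi>] assms] N
    by (simp add: is_primitive_def)
  finally show "(\<integral>x. deriv \<phi> x *\<^sub>R F x \<partial>lborel) = - (\<integral>x. \<phi> x *\<^sub>R f x \<partial>lborel)"
    using locally_integrable_test_function_mult[OF lF test_function_deriv[OF \<phi>]]
      locally_integrable_test_function_mult[OF lf \<phi>] by simp
qed

lemma locally_integrable_cong_AE:
  fixes f g :: "real \<Rightarrow> 'a::euclidean_space"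
  assumes "locally_integrable f" and ae: "AE x in lborel. f x = g x"
    and [measurable]: "g \<in> borel_measurable borel"
  shows "locally_integrable g"
proof -
  have [measurable]: "f \<in> borel_measurable borel"
    using assms by (auto simp: locally_integrable_def)
  have "set_integrable lborel {a..b} f \<longleftrightarrow> set_integrable lborel {a..b} g" for a b
    unfolding set_integrable_def using ae by (intro integrable_cong_AE) auto
  then show ?thesis using assms by (simp add: locally_integrable_def)
qed

lemma has_weak_deriv_cong_AE:
  fixes f g :: "real \<Rightarrow> 'a::euclidean_space"
  assumes fg: "has_weak_deriv f g"
    and ae: "AE x in lborel. f x = f' x" "AE x in lborel. g x = g' x"
    and [measurable]: "f' \<in> borel_measurable borel" "g' \<in> borel_measurable borel"
  shows "has_weak_deriv f' g'"
  unfolding has_weak_deriv_def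
proof safe
  have loc: "locally_integrable f" "locally_integrable g" using fg by (auto simp: has_weak_deriv_def)
  then have [measurable]: "f \<in> borel_measurable borel" "g \<in> borel_measurable borel"
    by (auto simp: locally_integrable_def)
  show "locally_integrable f'" "locally_integrable g'"
    using loc ae by (auto intro: locally_integrable_cong_AE)
  fix \<phi> assume \<phi>: "test_function \<phi>"
  have [measurable]: "\<phi> \<in> borel_measurable borel" "deriv \<phi> \<in> borel_measurable borel"
    using \<phi> test_function_deriv[OF \<phi>]
    by (auto intro!: borel_measurable_continuous_onI test_function_continuous_on)
  have "(\<integral>x. deriv \<phi> x *\<^sub>R f x \<partial>lborel) = (\<integral>x. deriv \<phi> x *\<^sub>R f' x \<partial>lborel)"
    by (rule integral_cong_AE) (use ae in auto)
  moreover have "(\<integral>x. \<phi> x *\<^sub>R g x \<partial>lborel) = (\<integral>x. \<phi> x *\<^sub>R g' x \<partial>lborel)"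
    by (rule integral_cong_AE) (use ae in auto)
  ultimately show "(\<integral>x. deriv \<phi> x *\<^sub>R f' x \<partial>lborel) = - (\<integral>x. \<phi> x *\<^sub>R g' x \<partial>lborel)"
    using fg \<phi> by (simp add: has_weak_deriv_def)
qed

lemma has_weak_deriv_unique:
  fixes f g g' :: "real \<Rightarrow> real"
  assumes "has_weak_deriv f g" "has_weak_deriv f g'"
  shows "AE x in lborel. g x = g' x"
proof -
  have l: "locally_integrable g" "locally_integrable g'" using assms by (auto simp: has_weak_deriv_def)
  have "AE x in lborel. g x - g' x = 0"
  proof (rule AE_zero_if_test_integrals_zero)
    show "locally_integrable (\<lambda>x. g x - g' x)" using l by (auto simp: locally_integrable_def)
    show "(\<integral>x. \<phi> x * (g x - g' x) \<partial>lborel) = 0" if \<phi>: "test_function \<phi>" for \<phi>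
      using assms \<phi> locally_integrable_test_function_mult[OF l(1) \<phi>]
        locally_integrable_test_function_mult[OF l(2) \<phi>]
      by (simp add: right_diff_distrib has_weak_deriv_def)
  qed
  then show ?thesis by simp
qed

section \<open>Passage from real-valued to complex-valued functions\<close>

lemma set_integrable_complex_iff:
  fixes f :: "real \<Rightarrow> complex"
  shows "set_integrable M A f \<longleftrightarrow>
    set_integrable M A (\<lambda>x. Re (f x)) \<and> set_integrable M A (\<lambda>x. Im (f x))"
proof safe
  assume f: "set_integrable M A f"
  show "set_integrable M A (\<lambda>x. Re (f x))" "set_integrable M A (\<lambda>x. Im (f x))"
    using integrable_Re[OF f[unfolded set_integrable_def]] integrable_Im[OF f[unfolded set_integrable_def]]
    by (simp_all add: set_integrable_def)
next
  assume "set_integrable M A (\<lambda>x. Re (f x))" "set_integrable M A (\<lambda>x. Im (f x))"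
  then have "integrable M (\<lambda>x. complex_of_real (indicator A x *\<^sub>R Re (f x)) + \<i> * complex_of_real (indicator A x *\<^sub>R Im (f x)))"
    unfolding set_integrable_def
    by (intro Bochner_Integration.integrable_add integrable_mult_right integrable_of_real)
  moreover have "complex_of_real (indicator A x *\<^sub>R Re (f x)) + \<i> * complex_of_real (indicator A x *\<^sub>R Im (f x))
      = indicator A x *\<^sub>R f x" for x
    by (simp add: complex_eq_iff)
  ultimately show "set_integrable M A f" by (simp add: set_integrable_def)
qed

lemma locally_integrable_complex_iff:
  fixes f :: "real \<Rightarrow> complex"
  shows "locally_integrable f \<longleftrightarrow>
    locally_integrable (\<lambda>x. Re (f x)) \<and> locally_integrable (\<lambda>x. Im (f x))"
  unfolding locally_integrable_def borel_measurable_complex_iff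
  by (subst set_integrable_complex_iff) auto

text \<open>Test functions are real, so the defining identity splits into its real and imaginary
  parts. This is how the real theory of primitives reaches complex profiles.\<close>

lemma has_weak_deriv_complex_iff:
  fixes f g :: "real \<Rightarrow> complex"
  shows "has_weak_deriv f g \<longleftrightarrow>
    has_weak_deriv (\<lambda>x. Re (f x)) (\<lambda>x. Re (g x)) \<and> has_weak_deriv (\<lambda>x. Im (f x)) (\<lambda>x. Im (g x))"
proof (cases "locally_integrable f \<and> locally_integrable g")
  case True
  have "(\<integral>x. deriv \<phi> x *\<^sub>R f x \<partial>lborel) = - (\<integral>x. \<phi> x *\<^sub>R g x \<partial>lborel) \<longleftrightarrow>
      (\<integral>x. deriv \<phi> x *\<^sub>R Re (f x) \<partial>lborel) = - (\<integral>x. \<phi> x *\<^sub>R Re (g x) \<partial>lborel) \<and>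
      (\<integral>x. deriv \<phi> x *\<^sub>R Im (f x) \<partial>lborel) = - (\<integral>x. \<phi> x *\<^sub>R Im (g x) \<partial>lborel)"
    if \<phi>: "test_function \<phi>" for \<phi>
  proof -
    have "integrable lborel (\<lambda>x. deriv \<phi> x *\<^sub>R f x)" "integrable lborel (\<lambda>x. \<phi> x *\<^sub>R g x)"
      using True \<phi> by (auto intro: locally_integrable_test_function_mult test_function_deriv)
    from this[THEN integral_Re] this[THEN integral_Im] show ?thesis
      by (simp add: complex_eq_iff)
  qed
  then show ?thesis using True locally_integrable_complex_iff[of f] locally_integrable_complex_iff[of g]
    unfolding has_weak_deriv_def by blast
next
  case False
  then show ?thesis using locally_integrable_complex_iff[of f] locally_integrable_complex_iff[of g]
    by (auto simp: has_weak_deriv_def)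
qed

text \<open>Exhibiting one weak derivative makes the choice in \<open>weak_deriv\<close> meaningful,
  and uniqueness then pins its values down almost everywhere. All later computations with
  \<open>weak_deriv\<close> rest on this.\<close>

lemma weak_deriv_AE_eq:
  fixes f g :: "real \<Rightarrow> complex"
  assumes "has_weak_deriv f g"
  shows "has_weak_deriv f (weak_deriv f)" "AE x in lborel. weak_deriv f x = g x"
proof -
  show *: "has_weak_deriv f (weak_deriv f)"
    unfolding weak_deriv_def by (rule someI[of "has_weak_deriv f", OF assms])
  have "AE x in lborel. Re (weak_deriv f x) = Re (g x)" "AE x in lborel. Im (weak_deriv f x) = Im (g x)"
    using * assms has_weak_deriv_unique unfolding has_weak_deriv_complex_iff by blast+
  then show "AE x in lborel. weak_deriv f x = g x"
    by eventually_elim (simp add: complex_eq_iff)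
qed

text \<open>The running integral started left of the support vanishes on the left, and to the right
  of the support it equals the total integral. Mean zero is therefore exactly what gives it bounded
  support.\<close>

lemma test_function_primitive:
  assumes \<phi>: "test_function \<phi>" and zero: "integral\<^sup>L lborel \<phi> = 0"
  obtains \<eta> where "test_function \<eta>" "deriv \<eta> = \<phi>"
proof -
  obtain M where M: "M > 0" "\<And>x. \<bar>x\<bar> > M \<Longrightarrow> \<phi> x = 0"
    using test_function_support[OF \<phi>] by metis
  have cont: "continuous_on UNIV \<phi>" by (rule test_function_continuous_on[OF \<phi>])
  define N where "N = M + 1"
  define \<eta> where "\<eta> x = (LBINT t=ereal (-N)..ereal x. \<phi> t)" for x
  have prim: "is_primitive \<eta> \<phi>"
    unfolding \<eta>_def[abs_def] by (intro is_primitive_interval_integral locally_integrable_continuous cont)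
  have D: "(\<eta> has_real_derivative \<phi> x) (at x)" for x
    by (rule is_primitive_DERIV[OF prim cont])
  have "times_differentiable n \<eta>" for n
  proof (rule times_differentiable_SucD)
    have "times_differentiable n \<phi>"
      using \<phi> times_differentiable_all_iff unfolding test_function_def by blast
    with D show "times_differentiable (Suc n) \<eta>" by auto
  qed
  moreover have "\<eta> x = 0" if x: "\<bar>x\<bar> > N" for x
  proof (cases "x < 0")
    case True
    have "(LINT t:{x..-N}|lborel. \<phi> t) = (LINT t:{x..-N}|lborel. 0)"
      by (intro set_lebesgue_integral_cong) (auto simp: N_def intro!: M)
    then have "\<eta> (-N) - \<eta> x = 0"
      using prim True x by (simp add: is_primitive_def)
    then show ?thesis by (simp add: \<eta>_def)
  next
    case False
    have supp: "\<phi> t = indicator {-N..x} t *\<^sub>R \<phi> t" for t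
      using M(2)[of t] x False by (cases "\<bar>t\<bar> > M") (auto simp: indicator_def N_def)
    have "integral\<^sup>L lborel \<phi> = (LINT t:{-N..x}|lborel. \<phi> t)"
      unfolding set_lebesgue_integral_def supp[symmetric] ..
    also have "\<dots> = \<eta> x - \<eta> (-N)"
    proof -
      have "-N \<le> x" using False M(1) by (simp add: N_def)
      then show ?thesis using prim by (simp add: is_primitive_def)
    qed
    finally show ?thesis using zero by (simp add: \<eta>_def)
  qed
  ultimately have "test_function \<eta>" by (rule test_functionI)
  moreover have "deriv \<eta> = \<phi>" using D by (auto intro: DERIV_imp_deriv)
  ultimately show thesis by (rule that)
qed

text \<open>Subtracting a multiple of a fixed bump turns any test function into one of mean zero, that is,
  into the derivative of a test function.\<close>

lemma weak_deriv_zero_imp_AE_const: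
  assumes h: "has_weak_deriv h (\<lambda>_. 0::real)"
  obtains c where "AE x in lborel. h x = c"
proof -
  define \<psi> where "\<psi> = plateau 1 0 1"
  \<comment> \<open>If \<open>h\<close> is constant almost everywhere, the constant has to be its
    mean weighted by the bump \<open>\<psi>\<close>.\<close>
  define c where "c = (\<integral>x. \<psi> x * h x \<partial>lborel) / integral\<^sup>L lborel \<psi>"
  have \<psi>: "test_function \<psi>" by (simp add: \<psi>_def test_function_plateau)
  have pos: "integral\<^sup>L lborel \<psi> \<noteq> 0" using plateau_integral_pos[of 0 1] by (simp add: \<psi>_def)
  have lh: "locally_integrable h" using h by (simp add: has_weak_deriv_def)
  have one: "locally_integrable (\<lambda>_. 1::real)" by (intro locally_integrable_continuous continuous_on_const)
  have i1: "integrable lborel \<phi>" and ih: "integrable lborel (\<lambda>x. \<phi> x * h x)" if "test_function \<phi>" for \<phi>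
    using locally_integrable_test_function_mult[OF one that] locally_integrable_test_function_mult[OF lh that]
    by simp_all
  have "AE x in lborel. h x - c = 0"
  proof (rule AE_zero_if_test_integrals_zero)
    show "locally_integrable (\<lambda>x. h x - c)"
      using locally_integrable_add[OF lh locally_integrable_continuous[of "\<lambda>_. -c"]] by simp
    fix \<phi> assume \<phi>: "test_function \<phi>"
    define r where "r = integral\<^sup>L lborel \<phi> / integral\<^sup>L lborel \<psi>"
    have t: "test_function (\<lambda>x. \<phi> x + (-r) * \<psi> x)" by (rule test_function_linear[OF \<phi> \<psi>])
    have "(\<integral>x. \<phi> x + (-r) * \<psi> x \<partial>lborel) = 0"
      using i1[OF \<phi>] i1[OF \<psi>] pos by (simp add: r_def)
    then obtain \<eta> where "test_function \<eta>" "deriv \<eta> = (\<lambda>x. \<phi> x + (-r) * \<psi> x)"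
      using test_function_primitive[OF t] by metis
    then have "(\<integral>x. (\<phi> x + (-r) * \<psi> x) *\<^sub>R h x \<partial>lborel) = 0"
      using h unfolding has_weak_deriv_def by (auto dest!: spec[of _ \<eta>])
    moreover have "(\<lambda>x. (\<phi> x + (-r) * \<psi> x) *\<^sub>R h x) = (\<lambda>x. \<phi> x * h x - r * (\<psi> x * h x))"
      by (auto simp: algebra_simps)
    ultimately have "(\<integral>x. \<phi> x * h x \<partial>lborel) = r * (\<integral>x. \<psi> x * h x \<partial>lborel)"
      using ih[OF \<phi>] ih[OF \<psi>] by simp
    also have "\<dots> = integral\<^sup>L lborel \<phi> * c" by (simp add: r_def c_def)
    finally show "(\<integral>x. \<phi> x * (h x - c) \<partial>lborel) = 0"
      using ih[OF \<phi>] i1[OF \<phi>] by (simp add: right_diff_distrib)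
  qed
  then have "AE x in lborel. h x = c" by simp
  then show thesis by (rule that)
qed

text \<open>The indefinite integral of \<open>g\<close> has the same weak derivative as
  \<open>f\<close>, so the difference is constant almost everywhere; adding that constant keeps a
  primitive of \<open>g\<close>.\<close>

lemma has_weak_deriv_obtains_primitive:
  fixes f g :: "real \<Rightarrow> real"
  assumes fg: "has_weak_deriv f g"
  obtains F where "is_primitive F g" "AE x in lborel. f x = F x"
proof -
  have lg: "locally_integrable g" and lf: "locally_integrable f" using fg by (auto simp: has_weak_deriv_def)
  define F where "F x = (LBINT t=ereal 0..ereal x. g t)" for x
  have F: "is_primitive F g"
    unfolding F_def[abs_def] by (rule is_primitive_interval_integral[OF lg])
  have lF: "locally_integrable F"
    by (intro locally_integrable_continuous is_primitive_continuous[OF F])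
  have "has_weak_deriv (\<lambda>x. f x - F x) (\<lambda>_. 0)"
    unfolding has_weak_deriv_def
  proof safe
    show "locally_integrable (\<lambda>x. f x - F x)" using lf lF by (auto simp: locally_integrable_def)
    show "locally_integrable (\<lambda>_. 0::real)" by (intro locally_integrable_continuous continuous_on_const)
    fix \<phi> assume \<phi>: "test_function \<phi>"
    note i = locally_integrable_test_function_mult[OF _ test_function_deriv[OF \<phi>]]
    show "(\<integral>x. deriv \<phi> x *\<^sub>R (f x - F x) \<partial>lborel) = - (\<integral>x. \<phi> x *\<^sub>R 0 \<partial>lborel)"
      using i[OF lf] i[OF lF] fg is_primitive_has_weak_deriv[OF F] \<phi>
      by (simp add: right_diff_distrib has_weak_deriv_def)
  qed
  then obtain c where c: "AE x in lborel. f x - F x = c"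
    using weak_deriv_zero_imp_AE_const by blast
  have "is_primitive (\<lambda>x. F x + c) g"
    using F by (simp add: is_primitive_def)
  moreover have "AE x in lborel. f x = F x + c" using c by eventually_elim simp
  ultimately show thesis by (rule that)
qed

text \<open>Tested against \<open>x \<mapsto> \<phi> (x / n)\<close>, whose derivative is \<open>O(1 / n)\<close>; this avoids discussing the
  limits of \<open>G\<close> at infinity.\<close>

lemma is_primitive_integral_zero:
  assumes prim: "is_primitive G g" and int: "integrable lborel G" "integrable lborel g"
  shows "integral\<^sup>L lborel g = 0"
proof -
  define \<phi> where "\<phi> = plateau 1 (-1) 1"
  have \<phi>: "test_function \<phi>" by (simp add: \<phi>_def test_function_plateau)
  obtain B where B: "\<And>x. \<bar>deriv \<phi> x\<bar> \<le> B"
    using test_function_bounded[OF test_function_deriv[OF \<phi>]] by metis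
  obtain C where C: "\<And>x. \<bar>\<phi> x\<bar> \<le> C" using test_function_bounded[OF \<phi>] by metis
  \<comment> \<open>\<open>Suc n\<close> keeps the scale positive for \<open>n = 0\<close>
    too.\<close>
  define r where "r n = 1 / real (Suc n)" for n
  have r: "r n > 0" for n by (simp add: r_def)
  have r0: "r \<longlonglongrightarrow> 0" unfolding r_def[abs_def] using LIMSEQ_inverse_real_of_nat by (simp add: inverse_eq_divide)
  have t: "test_function (\<lambda>x. \<phi> (r n * x + 0))" for n
  proof (rule test_functionI)
    have "times_differentiable k \<phi>" for k
      using \<phi> times_differentiable_all_iff unfolding test_function_def by blast
    then show "times_differentiable k (\<lambda>x. \<phi> (r n * x + 0))" for k
      by (rule times_differentiable_affine)
    show "\<phi> (r n * x + 0) = 0" if "\<bar>x\<bar> > real (Suc n)" for x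
    proof -
      have "\<bar>r n * x\<bar> > 1" using that by (simp add: r_def abs_mult field_simps)
      then have "r n * x \<notin> {-1..1}" by auto
      then show ?thesis using plateau_bounds[of 1 "-1" 1 "r n * x"] by (simp add: \<phi>_def)
    qed
  qed
  have "deriv (\<lambda>x. \<phi> (r n * x + 0)) x = r n * deriv \<phi> (r n * x)" for n x
  proof (rule DERIV_imp_deriv)
    have "((\<lambda>x. r n * x + 0) has_real_derivative r n) (at x)" by (auto intro!: derivative_eq_intros)
    from DERIV_chain2[OF test_function_DERIV[OF \<phi>] this]
    show "((\<lambda>x. \<phi> (r n * x + 0)) has_real_derivative r n * deriv \<phi> (r n * x)) (at x)"
      by (simp add: mult.commute)
  qed
  then have parts: "(\<integral>x. r n * deriv \<phi> (r n * x) * G x \<partial>lborel) = - (\<integral>x. \<phi> (r n * x) * g x \<partial>lborel)" for n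
    using is_primitive_has_weak_deriv[OF prim] t[of n] unfolding has_weak_deriv_def
    by (auto dest!: spec[of _ "\<lambda>x. \<phi> (r n * x + 0)"])
  have cont: "continuous_on A \<phi>" "continuous_on A (deriv \<phi>)" for A
    using \<phi> by (auto intro: test_function_continuous_on test_function_deriv)
  have [measurable]: "\<phi> \<in> borel_measurable borel" "deriv \<phi> \<in> borel_measurable borel"
    by (auto intro: borel_measurable_continuous_onI cont)
  have [measurable]: "g \<in> borel_measurable borel" "G \<in> borel_measurable borel"
    using int[THEN borel_measurable_integrable] by simp_all
  \<comment> \<open>One sequence is given two limits. Dominated convergence yields
    \<open>\<phi> 0\<close> times the integral of \<open>g\<close>; after \<open>parts\<close> the
    same terms are bounded by \<open>r n\<close> times a constant multiple of the integral of
    \<open>\<bar>G x\<bar>\<close>.\<close>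
  have "(\<lambda>n. \<integral>x. \<phi> (r n * x) * g x \<partial>lborel) \<longlonglongrightarrow> (\<integral>x. \<phi> 0 * g x \<partial>lborel)"
  proof (rule integral_dominated_convergence[where w="\<lambda>x. C * \<bar>g x\<bar>"])
    show "AE x in lborel. (\<lambda>n. \<phi> (r n * x) * g x) \<longlonglongrightarrow> \<phi> 0 * g x"
    proof (intro AE_I2 tendsto_mult tendsto_const)
      fix x
      have "(\<lambda>n. r n * x) \<longlonglongrightarrow> 0 * x" by (intro tendsto_intros r0)
      moreover have "isCont \<phi> 0" using test_function_DERIV[OF \<phi>] by (rule DERIV_isCont)
      ultimately show "(\<lambda>n. \<phi> (r n * x)) \<longlonglongrightarrow> \<phi> 0" by (auto intro: isCont_tendsto_compose)
    qed
  qed (use C int in \<open>auto simp: abs_mult intro!: mult_right_mono\<close>)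
  moreover have "(\<lambda>n. \<integral>x. \<phi> (r n * x) * g x \<partial>lborel) \<longlonglongrightarrow> 0"
  proof (rule Lim_null_comparison)
    have "norm (\<integral>x. \<phi> (r n * x) * g x \<partial>lborel) \<le> r n * (B * (\<integral>x. \<bar>G x\<bar> \<partial>lborel))" for n
    proof -
      have "norm (\<integral>x. \<phi> (r n * x) * g x \<partial>lborel) = norm (\<integral>x. r n * deriv \<phi> (r n * x) * G x \<partial>lborel)"
        by (simp add: parts)
      also have "\<dots> \<le> (\<integral>x. norm (r n * deriv \<phi> (r n * x) * G x) \<partial>lborel)"
        by (rule integral_norm_bound)
      also have "\<dots> \<le> (\<integral>x. r n * (B * \<bar>G x\<bar>) \<partial>lborel)"
      proof (rule integral_mono_AE')
        show "integrable lborel (\<lambda>x. r n * (B * \<bar>G x\<bar>))" using int by simp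
        show "AE x in lborel. norm (r n * deriv \<phi> (r n * x) * G x) \<le> r n * (B * \<bar>G x\<bar>)"
          using r[of n] B by (auto simp: abs_mult intro!: mult_left_mono mult_right_mono)
        have "0 \<le> B" using B[of 0] by linarith
        then show "AE x in lborel. 0 \<le> r n * (B * \<bar>G x\<bar>)" using r[of n] by simp
      qed
      finally show ?thesis by simp
    qed
    then show "\<forall>\<^sub>F n in sequentially. norm (\<integral>x. \<phi> (r n * x) * g x \<partial>lborel) \<le> r n * (B * (\<integral>x. \<bar>G x\<bar> \<partial>lborel))"
      by simp
    show "(\<lambda>n. r n * (B * (\<integral>x. \<bar>G x\<bar> \<partial>lborel))) \<longlonglongrightarrow> 0"
      using tendsto_mult_right[OF r0] by simp
  qed
  ultimately have "(\<integral>x. \<phi> 0 * g x \<partial>lborel) = 0" by (rule LIMSEQ_unique)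
  then have "\<phi> 0 * integral\<^sup>L lborel g = 0" by simp
  \<comment> \<open>The bump is not normalised: its value at the origin is
    \<open>exp (- 2)\<close>.\<close>
  moreover have "\<phi> 0 \<noteq> 0" by (simp add: \<phi>_def plateau_def flat_exp_def)
  ultimately show ?thesis by simp
qed

section \<open>Square-integrable functions and representatives of H^2 functions\<close>

lemma L2_mult_integrable:
  fixes f g :: "real \<Rightarrow> real"
  assumes "f \<in> L2" "g \<in> L2" shows "integrable lborel (\<lambda>x. f x * g x)"
proof (rule Bochner_Integration.integrable_bound)
  show "integrable lborel (\<lambda>x. (f x)\<^sup>2 + (g x)\<^sup>2)" using assms by (simp add: L2_def)
  show "(\<lambda>x. f x * g x) \<in> borel_measurable lborel" using assms by (auto simp: L2_def intro: borel_measurable_times)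
  have "\<bar>a * b\<bar> \<le> a\<^sup>2 + b\<^sup>2" for a b :: real
  proof -
    have "0 \<le> \<bar>a * b\<bar>" "2 * \<bar>a * b\<bar> \<le> a\<^sup>2 + b\<^sup>2"
      using sum_squares_bound[of "\<bar>a\<bar>" "\<bar>b\<bar>"] by (simp_all add: abs_mult)
    then show ?thesis by linarith
  qed
  then show "AE x in lborel. norm (f x * g x) \<le> norm ((f x)\<^sup>2 + (g x)\<^sup>2)" by simp
qed

text \<open>The embedding of H^1 into bounded functions. The derivative \<open>2 F f\<close> of
  \<open>F^2\<close> is integrable, so \<open>F^2\<close> never departs from \<open>(F 0)^2\<close>
  by more than the L^1 norm of that derivative.\<close>

lemma is_primitive_L2_bounded:
  assumes prim: "is_primitive F f" and L2: "F \<in> L2" "f \<in> L2"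
  obtains B where "\<And>x. \<bar>F x\<bar> \<le> B"
proof -
  define g where "g x = f x * F x + F x * f x" for x
  have int: "integrable lborel g"
    unfolding g_def using L2 by (intro Bochner_Integration.integrable_add L2_mult_integrable)
  have bound: "\<bar>LINT x:A|lborel. g x\<bar> \<le> (\<integral>x. \<bar>g x\<bar> \<partial>lborel)" if [measurable]: "A \<in> sets borel" for A
  proof -
    have "\<bar>LINT x:A|lborel. g x\<bar> \<le> (\<integral>x. norm (indicator A x *\<^sub>R g x) \<partial>lborel)"
      unfolding set_lebesgue_integral_def using integral_norm_bound[of lborel "\<lambda>x. indicator A x *\<^sub>R g x"] by simp
    also have "\<dots> \<le> (\<integral>x. \<bar>g x\<bar> \<partial>lborel)"
      by (rule integral_mono_AE') (use int in \<open>auto simp: indicator_def\<close>)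
    finally show ?thesis .
  qed
  have p: "is_primitive (\<lambda>x. F x * F x) g"
    unfolding g_def[abs_def] by (rule is_primitive_mult[OF prim prim])
  define C where "C = (F 0)\<^sup>2 + (\<integral>x. \<bar>g x\<bar> \<partial>lborel)"
  have "\<bar>F x\<bar> \<le> sqrt C" for x
  proof (rule real_le_rsqrt)
    have "\<bar>F x * F x - F 0 * F 0\<bar> \<le> (\<integral>x. \<bar>g x\<bar> \<partial>lborel)"
    proof (cases "0 \<le> x")
      case True
      with p bound[of "{0..x}"] show ?thesis by (simp add: is_primitive_def)
    next
      case False
      with p bound[of "{x..0}"] show ?thesis by (simp add: is_primitive_def)
    qed
    then show "\<bar>F x\<bar>\<^sup>2 \<le> C" by (simp add: C_def power2_eq_square)
  qed
  then show thesis by (rule that)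
qed

lemma L2_cong_AE:
  fixes f g :: "real \<Rightarrow> 'a::euclidean_space"
  assumes f: "f \<in> L2" and ae: "AE x in lborel. f x = g x" and [measurable]: "g \<in> borel_measurable borel"
  shows "g \<in> L2"
proof -
  have [measurable]: "f \<in> borel_measurable borel" using f by (simp add: L2_def)
  have "integrable lborel (\<lambda>x. (norm (f x))\<^sup>2) \<longleftrightarrow> integrable lborel (\<lambda>x. (norm (g x))\<^sup>2)"
    by (rule integrable_cong_AE) (use ae in auto)
  then show ?thesis using f by (simp add: L2_def)
qed

text \<open>The weak derivative of \<open>u\<close> is itself almost everywhere a primitive
  \<open>U1\<close>. Replacing the density of \<open>U\<close> by this continuous representative
  makes \<open>U\<close> continuously differentiable, and \<open>u2\<close> remains a mere L^2
  density.\<close>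

lemma sobolev_H2_primitives:
  fixes u :: "real \<Rightarrow> real"
  assumes "u \<in> sobolev_H 2"
  obtains U U1 u2 where "is_primitive U U1" "is_primitive U1 u2" "AE x in lborel. u x = U x"
    "U \<in> L2" "U1 \<in> L2" "u2 \<in> L2"
proof -
  obtain g h where u: "u \<in> L2" "has_weak_deriv u g" "g \<in> L2" "h \<in> L2" "has_weak_deriv g h"
    using assms by (auto simp: numeral_2_eq_2)
  obtain U where U: "is_primitive U g" "AE x in lborel. u x = U x"
    using has_weak_deriv_obtains_primitive[OF u(2)] by metis
  obtain G where G: "is_primitive G h" "AE x in lborel. g x = G x"
    using has_weak_deriv_obtains_primitive[OF u(5)] by metis
  have m: "U \<in> borel_measurable borel" "G \<in> borel_measurable borel"
    using U G by (auto intro!: borel_measurable_continuous_onI is_primitive_continuous)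
  have "is_primitive U G" by (rule is_primitive_cong_AE[OF U(1) G(2) m(2)])
  moreover have "U \<in> L2" "G \<in> L2" using L2_cong_AE[OF u(1) U(2) m(1)] L2_cong_AE[OF u(3) G(2) m(2)] by simp_all
  ultimately show thesis using that G U u by blast
qed

section \<open>Polynomials with integrable coefficients\<close>

definition bounded_measurable :: "(real \<Rightarrow> real) set" where
  "bounded_measurable = {f. f \<in> borel_measurable borel \<and> (\<exists>B. \<forall>x. \<bar>f x\<bar> \<le> B)}"

definition L1 :: "(real \<Rightarrow> real) set" where
  "L1 = {f. integrable lborel f}"

text \<open>The part of a vector space structure that coefficients of sums and products of
  polynomials require; it is shared by the bounded, the L^2 and the L^1 class.\<close>

definition linear_closed :: "(real \<Rightarrow> real) set \<Rightarrow> bool" where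
  "linear_closed C \<longleftrightarrow> (\<lambda>_. 0) \<in> C \<and> (\<forall>f\<in>C. \<forall>g\<in>C. (\<lambda>x. f x + g x) \<in> C) \<and>
     (\<forall>c. \<forall>f\<in>C. (\<lambda>x. c * f x) \<in> C)"

lemma linear_closedD:
  assumes "linear_closed C"
  shows "(\<lambda>_. 0) \<in> C" "f \<in> C \<Longrightarrow> g \<in> C \<Longrightarrow> (\<lambda>x. f x + g x) \<in> C" "f \<in> C \<Longrightarrow> (\<lambda>x. c * f x) \<in> C"
  using assms by (simp_all add: linear_closed_def)

lemma linear_closed_bounded_measurable: "linear_closed bounded_measurable"
  unfolding linear_closed_def
proof safe
  show "(\<lambda>_. 0) \<in> bounded_measurable" by (auto simp: bounded_measurable_def)
  fix f g :: "real \<Rightarrow> real" and c :: real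
  assume "f \<in> bounded_measurable"
  then obtain A where A: "f \<in> borel_measurable borel" "\<And>x. \<bar>f x\<bar> \<le> A"
    by (auto simp: bounded_measurable_def)
  have "\<bar>c * f x\<bar> \<le> \<bar>c\<bar> * A" for x using A by (simp add: abs_mult mult_left_mono)
  then show "(\<lambda>x. c * f x) \<in> bounded_measurable" using A by (auto simp: bounded_measurable_def)
  assume "g \<in> bounded_measurable"
  then obtain B where B: "g \<in> borel_measurable borel" "\<And>x. \<bar>g x\<bar> \<le> B"
    by (auto simp: bounded_measurable_def)
  have "\<bar>f x + g x\<bar> \<le> A + B" for x using A(2)[of x] B(2)[of x] by linarith
  then show "(\<lambda>x. f x + g x) \<in> bounded_measurable" using A B by (auto simp: bounded_measurable_def)
qed

lemma linear_closed_L2: "linear_closed (L2 :: (real \<Rightarrow> real) set)"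
  unfolding linear_closed_def
proof safe
  show "(\<lambda>_. 0::real) \<in> L2" by (auto simp: L2_def)
  fix f g :: "real \<Rightarrow> real" and c :: real
  assume f: "f \<in> L2"
  then show "(\<lambda>x. c * f x) \<in> L2" by (auto simp: L2_def power_mult_distrib)
  assume g: "g \<in> L2"
  have "integrable lborel (\<lambda>x. (f x)\<^sup>2 + (g x)\<^sup>2 + 2 * (f x * g x))"
    using f g L2_mult_integrable[OF f g] by (simp add: L2_def)
  then show "(\<lambda>x. f x + g x) \<in> L2" using f g borel_measurable_add[of f lborel g]
    by (simp add: L2_def power2_sum algebra_simps)
qed

lemma linear_closed_L1: "linear_closed L1"
  by (auto simp: linear_closed_def L1_def)

lemma bounded_measurable_mult:
  assumes "f \<in> bounded_measurable" "g \<in> bounded_measurable"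
  shows "(\<lambda>x. f x * g x) \<in> bounded_measurable"
proof -
  from assms obtain A B where "f \<in> borel_measurable borel" "g \<in> borel_measurable borel"
      "\<And>x. \<bar>f x\<bar> \<le> A" "\<And>x. \<bar>g x\<bar> \<le> B"
    by (auto simp: bounded_measurable_def)
  moreover from this have "\<bar>f x * g x\<bar> \<le> A * B" for x
    unfolding abs_mult by (intro mult_mono) (auto intro: order_trans[OF abs_ge_zero])
  ultimately show ?thesis by (auto simp: bounded_measurable_def)
qed

lemma bounded_measurable_mult_L1:
  assumes "f \<in> bounded_measurable" "g \<in> L1"
  shows "(\<lambda>x. f x * g x) \<in> L1"
proof -
  from assms obtain A where A: "f \<in> borel_measurable borel" "\<And>x. \<bar>f x\<bar> \<le> A"
    and g: "integrable lborel g"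
    by (auto simp: bounded_measurable_def L1_def)
  have [measurable]: "f \<in> borel_measurable borel" "g \<in> borel_measurable borel"
    using A g borel_measurable_integrable[OF g] by simp_all
  have "integrable lborel (\<lambda>x. f x * g x)"
  proof (rule Bochner_Integration.integrable_bound)
    show "integrable lborel (\<lambda>x. A * g x)" using g by simp
    show "AE x in lborel. norm (f x * g x) \<le> norm (A * g x)"
    proof (rule AE_I2)
      fix x
      have "\<bar>f x\<bar> \<le> \<bar>A\<bar>" using A(2)[of x] by linarith
      then show "norm (f x * g x) \<le> norm (A * g x)" by (simp add: abs_mult mult_right_mono)
    qed
  qed simp
  then show ?thesis by (simp add: L1_def)
qed

lemma bounded_measurable_mult_L2:
  assumes f: "f \<in> bounded_measurable" and g: "g \<in> L2"
  shows "(\<lambda>x. f x * g x) \<in> L2"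
proof -
  have "(\<lambda>x. (g x)\<^sup>2) \<in> L1" using g by (simp add: L2_def L1_def)
  with f have "(\<lambda>x. (f x * f x) * (g x)\<^sup>2) \<in> L1"
    by (intro bounded_measurable_mult_L1 bounded_measurable_mult)
  moreover have "(\<lambda>x. f x * g x) \<in> borel_measurable borel"
    using f g by (auto simp: bounded_measurable_def L2_def intro: borel_measurable_times)
  ultimately show ?thesis by (simp add: L1_def L2_def power2_eq_square mult_ac)
qed

lemma L2_mult_L1: "f \<in> L2 \<Longrightarrow> g \<in> L2 \<Longrightarrow> (\<lambda>x. f x * g x) \<in> L1"
  using L2_mult_integrable by (simp add: L1_def)

text \<open>Families of polynomials in \<open>s\<close>, indexed by the space variable, replace differentiation under the
  integral sign. The degree bound must be uniform for the integral to be a polynomial again.\<close>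

definition coeffs_in :: "(real \<Rightarrow> real) set \<Rightarrow> (real \<Rightarrow> real poly) \<Rightarrow> bool" where
  "coeffs_in C p \<longleftrightarrow> (\<exists>N. \<forall>x. degree (p x) \<le> N) \<and> (\<forall>k. (\<lambda>x. coeff (p x) k) \<in> C)"

lemma linear_closed_sum:
  assumes "linear_closed C" "finite I" "\<And>i. i \<in> I \<Longrightarrow> f i \<in> C"
  shows "(\<lambda>x. \<Sum>i\<in>I. f i x) \<in> C"
  using assms(2,3) assms(1) by (induction I) (auto simp: linear_closed_def)

lemma coeffs_in_add:
  assumes C: "linear_closed C" and p: "coeffs_in C p" and q: "coeffs_in C q"
  shows "coeffs_in C (\<lambda>x. p x + q x)"
proof -
  obtain M N where "\<And>x. degree (p x) \<le> M" "\<And>x. degree (q x) \<le> N"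
    using p q by (auto simp: coeffs_in_def)
  then have "degree (p x + q x) \<le> max M N" for x
    by (meson degree_add_le max.coboundedI1 max.coboundedI2)
  then show ?thesis using C p q by (auto simp: coeffs_in_def linear_closed_def)
qed

text \<open>Coefficients of a product are finite convolution sums, so a multiplication rule between
  function classes lifts to polynomials, and degree bounds add.\<close>

lemma coeffs_in_mult:
  assumes C: "linear_closed C" and AB: "\<And>f g. f \<in> A \<Longrightarrow> g \<in> B \<Longrightarrow> (\<lambda>x. f x * g x) \<in> C"
    and p: "coeffs_in A p" and q: "coeffs_in B q"
  shows "coeffs_in C (\<lambda>x. p x * q x)"
proof -
  obtain M N where "\<And>x. degree (p x) \<le> M" "\<And>x. degree (q x) \<le> N"
    using p q by (auto simp: coeffs_in_def)
  then have "degree (p x * q x) \<le> M + N" for x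
    by (meson degree_mult_le add_mono order_trans)
  moreover have "(\<lambda>x. coeff (p x * q x) k) \<in> C" for k
    unfolding coeff_mult by (intro linear_closed_sum C AB) (use p q in \<open>auto simp: coeffs_in_def\<close>)
  ultimately show ?thesis by (auto simp: coeffs_in_def)
qed

lemma coeffs_in_mult_classes:
  shows "coeffs_in L2 p \<Longrightarrow> coeffs_in L2 q \<Longrightarrow> coeffs_in L1 (\<lambda>x. p x * q x)"
    and "coeffs_in bounded_measurable p \<Longrightarrow> coeffs_in L1 q \<Longrightarrow> coeffs_in L1 (\<lambda>x. p x * q x)"
    and "coeffs_in bounded_measurable p \<Longrightarrow> coeffs_in L2 q \<Longrightarrow> coeffs_in L2 (\<lambda>x. p x * q x)"
    and "coeffs_in bounded_measurable p \<Longrightarrow> coeffs_in bounded_measurable q \<Longrightarrow>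
      coeffs_in bounded_measurable (\<lambda>x. p x * q x)"
  by (rule coeffs_in_mult[OF linear_closed_L1 L2_mult_L1]
        coeffs_in_mult[OF linear_closed_L1 bounded_measurable_mult_L1]
        coeffs_in_mult[OF linear_closed_L2 bounded_measurable_mult_L2]
        coeffs_in_mult[OF linear_closed_bounded_measurable bounded_measurable_mult]; assumption)+

lemma coeffs_in_pCons:
  assumes f: "f \<in> C" and p: "coeffs_in C p"
  shows "coeffs_in C (\<lambda>x. pCons (f x) (p x))"
proof -
  obtain N where "\<And>x. degree (p x) \<le> N" using p by (auto simp: coeffs_in_def)
  then have "degree (pCons (f x) (p x)) \<le> Suc N" for x
    by (meson degree_pCons_le Suc_le_mono order_trans)
  moreover have "(\<lambda>x. coeff (pCons (f x) (p x)) k) \<in> C" for k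
    using f p by (cases k) (auto simp: coeffs_in_def)
  ultimately show ?thesis unfolding coeffs_in_def by blast
qed

lemma coeffs_in_0: "linear_closed C \<Longrightarrow> coeffs_in C (\<lambda>_. 0)"
  by (auto simp: coeffs_in_def linear_closed_def)

lemma poly_eq_sum_coeff:
  fixes p :: "'a::comm_semiring_1 poly"
  shows "degree p \<le> N \<Longrightarrow> poly p s = (\<Sum>i\<le>N. coeff p i * s ^ i)"
  unfolding poly_altdef by (intro sum.mono_neutral_left) (auto simp: coeff_eq_0)

lemma coeffs_in_poly:
  assumes C: "linear_closed C" and p: "coeffs_in C p"
  shows "(\<lambda>x. poly (p x) s) \<in> C"
proof -
  obtain N where N: "\<And>x. degree (p x) \<le> N" using p by (auto simp: coeffs_in_def)
  have "(\<lambda>x. \<Sum>i\<le>N. s ^ i * coeff (p x) i) \<in> C"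
    by (rule linear_closed_sum[OF C]) (use C p in \<open>auto simp: linear_closed_def coeffs_in_def\<close>)
  moreover have "(\<Sum>i\<le>N. s ^ i * coeff (p x) i) = poly (p x) s" for x
    by (simp add: poly_eq_sum_coeff[OF N] mult.commute)
  ultimately show ?thesis by simp
qed

text \<open>The uniform degree bound turns the integrand into one finite sum with integrable
  coefficients, and the powers of \<open>s\<close> come out of the integral.\<close>

lemma coeffs_in_L1_integral:
  assumes p: "coeffs_in L1 p"
  obtains Q where "\<And>s. (\<integral>x. poly (p x) s \<partial>lborel) = poly Q s"
    "\<And>k. coeff Q k = (\<integral>x. coeff (p x) k \<partial>lborel)"
proof -
  obtain N where N: "\<And>x. degree (p x) \<le> N" using p by (auto simp: coeffs_in_def)
  define Q where "Q = (\<Sum>i\<le>N. monom (\<integral>x. coeff (p x) i \<partial>lborel) i)"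
  have c: "coeff Q k = (\<integral>x. coeff (p x) k \<partial>lborel)" for k
  proof (cases "k \<le> N")
    case True
    then show ?thesis by (simp add: Q_def coeff_sum sum.delta)
  next
    case False
    then have "coeff (p x) k = 0" for x
      using N[of x] by (intro coeff_eq_0) linarith
    with False show ?thesis by (simp add: Q_def coeff_sum sum.delta)
  qed
  have int: "integrable lborel (\<lambda>x. coeff (p x) i)" for i
    using p by (auto simp: coeffs_in_def L1_def)
  have "(\<integral>x. poly (p x) s \<partial>lborel) = poly Q s" for s
  proof -
    have "(\<integral>x. poly (p x) s \<partial>lborel) = (\<integral>x. (\<Sum>i\<le>N. coeff (p x) i * s ^ i) \<partial>lborel)"
      by (simp add: poly_eq_sum_coeff[OF N])
    also have "\<dots> = poly Q s"
      using int by (simp add: Q_def poly_sum poly_monom)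
    finally show ?thesis .
  qed
  with c show thesis by (rule that[rotated])
qed

lemma twice_differentiable_at_poly: "twice_differentiable_at (poly p) a"
proof -
  have "deriv (poly q) = poly (pderiv q)" for q :: "real poly"
    by (auto intro: DERIV_imp_deriv poly_DERIV)
  moreover have "poly q differentiable (at x)" for q :: "real poly" and x
    using poly_DERIV by (rule real_differentiable_def[THEN iffD2, OF exI])
  ultimately show ?thesis by (simp add: twice_differentiable_at_def)
qed

lemma deriv_deriv_poly_0: "deriv (deriv (poly p)) 0 = 2 * coeff p 2" for p :: "real poly"
proof -
  have "deriv (poly q) = poly (pderiv q)" for q :: "real poly"
    by (auto intro: DERIV_imp_deriv poly_DERIV)
  then show ?thesis by (simp add: poly_0_coeff_0 coeff_pderiv numeral_2_eq_2)
qed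

section \<open>The kink and the decay of \<open>1 - kink^2\<close>\<close>

definition kink :: "real \<Rightarrow> real" where
  "kink x = tanh (x / sqrt 2)"

lemma kink_DERIV: "(kink has_real_derivative (1 - (kink x)\<^sup>2) / sqrt 2) (at x)"
  unfolding kink_def[abs_def] by (auto intro!: derivative_eq_intros simp: field_simps)

lemma kink_continuous: "continuous_on A kink"
  by (meson DERIV_isCont continuous_at_imp_continuous_on kink_DERIV)

lemma kink_bounds: "\<bar>kink x\<bar> \<le> 1"
  using tanh_real_bounds[of "x / sqrt 2"] by (auto simp: kink_def)

lemma kink_bounded_measurable: "kink \<in> bounded_measurable"
  using kink_bounds kink_continuous
  by (auto simp: bounded_measurable_def intro!: borel_measurable_continuous_onI)

lemma one_minus_kink_sq_nonneg: "0 \<le> 1 - (kink x)\<^sup>2"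
  using kink_bounds[of x] abs_le_square_iff[of "kink x" 1] by simp

text \<open>\<open>1 - kink^2\<close> is \<open>sqrt 2\<close> times the nonnegative derivative of a
  function with limits at both infinities, hence integrable by the fundamental theorem. Its values
  lie in \<open>[0, 1]\<close>, so its square is dominated by it.\<close>

lemma one_minus_kink_sq_L2: "(\<lambda>x. 1 - (kink x)\<^sup>2) \<in> L2"
proof -
  have lim: "(kink \<longlongrightarrow> 1) at_top" "(kink \<longlongrightarrow> -1) at_bot"
  proof -
    have "filterlim (\<lambda>x. (1 / sqrt 2) * x) at_top at_top"
      by (intro filterlim_tendsto_pos_mult_at_top[OF tendsto_const]) (auto simp: filterlim_ident)
    from filterlim_compose[OF tanh_real_at_top this] show "(kink \<longlongrightarrow> 1) at_top"
      by (simp add: kink_def[abs_def])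
    have "filterlim (\<lambda>x. (1 / sqrt 2) * x) at_bot at_bot"
      by (intro filterlim_tendsto_pos_mult_at_bot[OF tendsto_const]) (auto simp: filterlim_ident)
    from filterlim_compose[OF tanh_real_at_bot this] show "(kink \<longlongrightarrow> -1) at_bot"
      by (simp add: kink_def[abs_def])
  qed
  have cont: "continuous_on UNIV (\<lambda>x. 1 - (kink x)\<^sup>2)" by (intro continuous_intros kink_continuous)
  have "set_integrable lborel (einterval (-\<infinity>) \<infinity>) (\<lambda>x. (1 - (kink x)\<^sup>2) / sqrt 2)"
  proof (rule interval_integral_FTC_nonneg(1))
    show "isCont (\<lambda>x. (1 - (kink x)\<^sup>2) / sqrt 2) x" for x
      using cont by (auto simp: continuous_on_eq_continuous_at intro!: continuous_intros)
    show "((kink \<circ> real_of_ereal) \<longlongrightarrow> -1) (at_right (-\<infinity>))" "((kink \<circ> real_of_ereal) \<longlongrightarrow> 1) (at_left \<infinity>)"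
      using lim by (simp_all add: ereal_tendsto_simps)
  qed (use kink_DERIV one_minus_kink_sq_nonneg in auto)
  then have "integrable lborel (\<lambda>x. sqrt 2 * ((1 - (kink x)\<^sup>2) / sqrt 2))"
    by (intro integrable_mult_right) (simp add: set_integrable_def)
  then have int: "integrable lborel (\<lambda>x. 1 - (kink x)\<^sup>2)"
    by simp
  have [measurable]: "kink \<in> borel_measurable borel"
    using kink_continuous by (rule borel_measurable_continuous_onI)
  have "integrable lborel (\<lambda>x. (1 - (kink x)\<^sup>2)\<^sup>2)"
  proof (rule Bochner_Integration.integrable_bound[OF int])
    have "t\<^sup>2 \<le> t" if "0 \<le> t" "t \<le> 1" for t :: real
      using that mult_left_le[of t t] by (simp add: power2_eq_square)
    then show "AE x in lborel. norm ((1 - (kink x)\<^sup>2)\<^sup>2) \<le> norm (1 - (kink x)\<^sup>2)"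
      using one_minus_kink_sq_nonneg by simp
  qed simp
  then show ?thesis by (simp add: L2_def)
qed

text \<open>Pointwise algebra in which \<open>u\<close>, \<open>u1\<close>, \<open>u2\<close>,
  \<open>v\<close>, \<open>v1\<close>, \<open>v2\<close> are independent variables; of the kink only
  its first-order equation enters. The left side is the \<open>s^2\<close> coefficient of the
  density: for \<open>F(r) = (1 - r)^2 (1 + r / 2)\<close> one has
  \<open>F'(r) = - 3 / 2 (1 - r^2)\<close> and \<open>F''(r) = 3 r\<close>, which at
  \<open>r = w^2\<close> gives the two terms in \<open>w ^ 4\<close>. The last bracket on the right
  is the derivative of \<open>flux\<close>, written out by the product rule.\<close>

lemma second_variation_density_identity:
  fixes q :: real
  assumes q: "q\<^sup>2 = 2"
    and w1: "2 * w1 = q * (1 - w\<^sup>2)"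
  shows "u2\<^sup>2 + v2\<^sup>2 + 3 * (w\<^sup>2 * (u1\<^sup>2 + v1\<^sup>2) + 4 * w * w1 * u * u1 + w1\<^sup>2 * (u\<^sup>2 + v\<^sup>2))
      + 2 * ((w * u1 + w1 * u)\<^sup>2 + 2 * w * w1 * (u * u1 + v * v1))
      - 3 / 2 * (1 - w ^ 4) * (u\<^sup>2 + v\<^sup>2) + 6 * w ^ 4 * u\<^sup>2
      - 2 * (u1\<^sup>2 + v1\<^sup>2) + 2 * (1 - w\<^sup>2) * (u\<^sup>2 + v\<^sup>2) - 4 * w\<^sup>2 * u\<^sup>2
    = (v2 + (1 - w\<^sup>2) * v)\<^sup>2 + (w * v1 - w1 * v)\<^sup>2
      + (u2 + q * (w1 * u + w * u1))\<^sup>2 + (u1 + q * w * u)\<^sup>2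
      + (((1 - w\<^sup>2) * (3 * (1 - w\<^sup>2) - 1) - 6 * w\<^sup>2 * (1 - w\<^sup>2)) * u\<^sup>2
         + 2 * q * w * (3 * (1 - w\<^sup>2) - 1) * u * u1
         + 2 * q * w * (1 - w\<^sup>2) * u * u1 - 2 * (1 - w\<^sup>2) * (u1\<^sup>2 + u * u2)
         - (1 - w\<^sup>2) * u1\<^sup>2 - 2 * q * w * u1 * u2
         + ((1 - w\<^sup>2)\<^sup>2 / 2 - w\<^sup>2 * (1 - w\<^sup>2)) * v\<^sup>2 + q * w * (1 - w\<^sup>2) * v * v1
         + 2 * q * w * (1 - w\<^sup>2) * v * v1 - 2 * (1 - w\<^sup>2) * (v1\<^sup>2 + v * v2))"
proof -
  have w1': "w1 = q * (1 - w\<^sup>2) / 2" using w1 by simp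
  have q2: "q * q = 2" "q * (q * x) = 2 * x" for x
    using q by (auto simp: power2_eq_square simp flip: mult.assoc)
  show ?thesis unfolding w1'
    by (simp add: power2_eq_square power4_eq_xxxx q2 algebra_simps add_divide_distrib diff_divide_distrib)
qed

section \<open>The second variation at the kink\<close>

definition kink_deriv :: "real \<Rightarrow> real" where
  "kink_deriv x = (1 - (kink x)\<^sup>2) / sqrt 2"

text \<open>The second derivative as given by the profile equation
  \<open>w'' = - w (1 - w^2)\<close>.\<close>

definition kink_deriv2 :: "real \<Rightarrow> real" where
  "kink_deriv2 x = - kink x * (1 - (kink x)\<^sup>2)"

lemma kink_deriv_continuous: "continuous_on A kink_deriv" "continuous_on A kink_deriv2"
  unfolding kink_deriv_def[abs_def] kink_deriv2_def[abs_def]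
  by (intro continuous_intros kink_continuous; simp)+

lemma kink_is_primitive: "is_primitive kink kink_deriv"
  using kink_DERIV kink_deriv_continuous(1) by (intro DERIV_is_primitive) (simp_all add: kink_deriv_def)

lemma kink_deriv_DERIV: "(kink_deriv has_real_derivative kink_deriv2 x) (at x)"
proof -
  have "(kink_deriv has_real_derivative (- (2 * kink x * ((1 - (kink x)\<^sup>2) / sqrt 2))) / sqrt 2) (at x)"
    unfolding kink_deriv_def[abs_def] by (auto intro!: derivative_eq_intros kink_DERIV)
  moreover have "(- (2 * kink x * ((1 - (kink x)\<^sup>2) / sqrt 2))) / sqrt 2 = kink_deriv2 x"
    by (simp add: kink_deriv2_def field_simps)
  ultimately show ?thesis by simp
qed

lemma kink_deriv_is_primitive: "is_primitive kink_deriv kink_deriv2"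
  by (intro DERIV_is_primitive kink_deriv_DERIV kink_deriv_continuous)

lemma kink_deriv_L2: "kink_deriv \<in> L2" "kink_deriv2 \<in> L2"
proof -
  have "(\<lambda>x. (1 / sqrt 2) * (1 - (kink x)\<^sup>2)) \<in> L2"
    by (intro linear_closedD(3) linear_closed_L2 one_minus_kink_sq_L2)
  then show "kink_deriv \<in> L2" by (simp add: kink_deriv_def[abs_def])
  have "(\<lambda>x. - 1 * (kink x * (1 - (kink x)\<^sup>2))) \<in> L2"
    by (intro linear_closedD(3) linear_closed_L2 bounded_measurable_mult_L2 kink_bounded_measurable
          one_minus_kink_sq_L2)
  then show "kink_deriv2 \<in> L2" by (simp add: kink_deriv2_def[abs_def])
qed

section \<open>Local square integrability and complex assembly\<close>

lemma L2_subset_L2_loc: "(L2 :: (real \<Rightarrow> 'a::euclidean_space) set) \<subseteq> L2_loc"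
  unfolding L2_def L2_loc_def set_integrable_def
  by (auto intro!: integrable_mult_indicator simp del: real_scaleR_def)

lemma L2_loc_cong_AE:
  fixes f g :: "real \<Rightarrow> 'a::euclidean_space"
  assumes f: "f \<in> L2_loc" and ae: "AE x in lborel. f x = g x" and [measurable]: "g \<in> borel_measurable borel"
  shows "g \<in> L2_loc"
proof -
  have [measurable]: "f \<in> borel_measurable borel" using f by (simp add: L2_loc_def)
  have "set_integrable lborel {a..b} (\<lambda>x. (norm (f x))\<^sup>2) \<longleftrightarrow> set_integrable lborel {a..b} (\<lambda>x. (norm (g x))\<^sup>2)" for a b
    unfolding set_integrable_def by (rule integrable_cong_AE) (use ae in auto)
  then show ?thesis using f by (simp add: L2_loc_def)
qed

lemma continuous_L2_loc:
  fixes f :: "real \<Rightarrow> 'a::euclidean_space"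
  assumes "continuous_on UNIV f" shows "f \<in> L2_loc"
proof -
  have "set_integrable lborel {a..b} (\<lambda>x. (norm (f x))\<^sup>2)" for a b
    by (intro borel_integrable_atLeastAtMost' continuous_intros continuous_on_subset[OF assms]) auto
  then show ?thesis using borel_measurable_continuous_onI[OF assms] by (simp add: L2_loc_def)
qed

lemma Complex_measurable:
  assumes "f \<in> borel_measurable M" "g \<in> borel_measurable M"
  shows "(\<lambda>x. Complex (f x) (g x)) \<in> borel_measurable M"
  using assms by (simp add: borel_measurable_complex_iff)

lemma Complex_L2:
  assumes "f \<in> L2" "g \<in> L2" shows "(\<lambda>x. Complex (f x) (g x)) \<in> L2"
  using assms by (auto simp: L2_def cmod_power2 Complex_measurable)

text \<open>Fixes the good representatives: \<open>U\<close>, \<open>U1\<close>, \<open>V\<close>,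
  \<open>V1\<close> are continuous, \<open>u2\<close> and \<open>v2\<close> only L^2 densities. The
  polynomial identities can then be proved at every point, and null sets enter only when an actual
  profile is compared with these data.\<close>

locale H2_perturbation =
  fixes U U1 u2 V V1 v2 :: "real \<Rightarrow> real"
  assumes prim: "is_primitive U U1" "is_primitive U1 u2" "is_primitive V V1" "is_primitive V1 v2"
    and L2: "U \<in> L2" "U1 \<in> L2" "u2 \<in> L2" "V \<in> L2" "V1 \<in> L2" "v2 \<in> L2"
begin

definition re0 where "re0 x = [:kink x, U x:]"
definition re1 where "re1 x = [:kink_deriv x, U1 x:]"
definition re2 where "re2 x = [:kink_deriv2 x, u2 x:]"
definition im0 where "im0 x = [:0, V x:]"
definition im1 where "im1 x = [:0, V1 x:]"
definition im2 where "im2 x = [:0, v2 x:]"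
text \<open>The expansion of \<open>1 - |psi|^2\<close> in \<open>s\<close>, stored by coefficients.
  The constant term is in L^2 only because \<open>1\<close> and \<open>kink^2\<close> are kept
  together; the \<open>s^2\<close> term is in L^2 because \<open>U\<close> and \<open>V\<close> are
  bounded as well as square integrable.\<close>

definition defect where "defect x = [:1 - (kink x)\<^sup>2, - 2 * (kink x * U x), - 1 * (U x * U x + V x * V x):]"

lemmas poly_defs = re0_def re1_def re2_def im0_def im1_def im2_def

definition E_density where
  "E_density x = (re1 x * re1 x + im1 x * im1 x) + [:1/2:] * (defect x * defect x)"

text \<open>\<open>re0 * re1 + im0 * im1\<close> is the real part of \<open>cnj psi * psi'\<close>.
  The sum of that product and its conjugate is twice this, so the factor \<open>1/2\<close> on the
  square becomes \<open>2\<close>.\<close>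

definition S_density where
  "S_density x = (re2 x * re2 x + im2 x * im2 x)
     + [:3:] * ((re0 x * re0 x + im0 x * im0 x) * (re1 x * re1 x + im1 x * im1 x))
     + [:2:] * ((re0 x * re1 x + im0 x * im1 x) * (re0 x * re1 x + im0 x * im1 x))
     + ([:1:] + [:1/2:] * (re0 x * re0 x + im0 x * im0 x)) * (defect x * defect x)"

definition Lam_density where
  "Lam_density x = S_density x + [:-2:] * E_density x"

lemma defect_eq: "defect x = 1 - (re0 x * re0 x + im0 x * im0 x)"
  by (simp add: defect_def re0_def im0_def power2_eq_square one_pCons algebra_simps)

lemma bounded: "U \<in> bounded_measurable" "V \<in> bounded_measurable" "U1 \<in> bounded_measurable" "V1 \<in> bounded_measurable"
proof -
  have "F \<in> bounded_measurable" if F: "is_primitive F f" "F \<in> L2" "f \<in> L2" for F f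
  proof -
    obtain B where "\<And>x. \<bar>F x\<bar> \<le> B" using is_primitive_L2_bounded[OF F] by blast
    then show ?thesis using F(2) by (auto simp: bounded_measurable_def L2_def)
  qed
  then show "U \<in> bounded_measurable" "V \<in> bounded_measurable" "U1 \<in> bounded_measurable" "V1 \<in> bounded_measurable"
    using prim L2 by blast+
qed

lemma L2_mult: "(\<lambda>x. U x * U x) \<in> L2" "(\<lambda>x. V x * V x) \<in> L2"
  using bounded L2 by (auto intro: bounded_measurable_mult_L2)

text \<open>The factors \<open>re0\<close> and \<open>im0\<close> are merely bounded; derivatives
  and \<open>defect\<close> are in L^2. Every summand of a density contains two factors of the
  second kind, with bounded factors besides.\<close>

lemma coeffs_in_densities: "coeffs_in L1 S_density" "coeffs_in L1 E_density" "coeffs_in L2 defect"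
proof -
  note c2 = coeffs_in_pCons[OF _ coeffs_in_pCons[OF _ coeffs_in_0]]
  note closed = linear_closed_bounded_measurable linear_closed_L2 linear_closed_L1
  have zero: "(\<lambda>_. 0) \<in> bounded_measurable" "(\<lambda>_. 0::real) \<in> L2"
    by (intro linear_closedD closed)+
  have const: "coeffs_in bounded_measurable (\<lambda>_. [:c:])" for c
    by (intro coeffs_in_pCons coeffs_in_0 closed) (auto simp: bounded_measurable_def)
  have b: "coeffs_in bounded_measurable re0" "coeffs_in bounded_measurable im0"
    unfolding re0_def[abs_def] im0_def[abs_def]
    by (intro c2 closed kink_bounded_measurable bounded zero)+
  have l: "coeffs_in L2 re1" "coeffs_in L2 re2" "coeffs_in L2 im1" "coeffs_in L2 im2"
    unfolding poly_defs[abs_def]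
    by (intro c2 closed kink_deriv_L2 L2 zero)+
  note ad = linear_closedD(2)[OF linear_closed_L2] and cm = linear_closedD(3)[OF linear_closed_L2]
  show d: "coeffs_in L2 defect"
    unfolding defect_def[abs_def]
    by (intro coeffs_in_pCons[OF _ c2] closed one_minus_kink_sq_L2 cm ad L2_mult
         bounded_measurable_mult_L2 kink_bounded_measurable L2)
  note add = coeffs_in_add[OF linear_closed_L1] coeffs_in_add[OF linear_closed_bounded_measurable] coeffs_in_add[OF linear_closed_L2]
  note mult = coeffs_in_mult_classes
  have sq: "coeffs_in bounded_measurable (\<lambda>x. re0 x * re0 x + im0 x * im0 x)"
    by (intro add(2) mult(4) b)
  have dsq: "coeffs_in L1 (\<lambda>x. re1 x * re1 x + im1 x * im1 x)" "coeffs_in L1 (\<lambda>x. re2 x * re2 x + im2 x * im2 x)"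
    "coeffs_in L1 (\<lambda>x. defect x * defect x)"
    by (intro add(1) mult(1) l d)+
  have mix: "coeffs_in L2 (\<lambda>x. re0 x * re1 x + im0 x * im1 x)"
    by (intro add(3) mult(3) b l)
  show "coeffs_in L1 S_density" unfolding S_density_def[abs_def]
    by (intro add(1) dsq mult(2)[OF const] mult(2)[OF sq] mult(1)[OF mix mix]
          mult(2)[OF add(2)[OF const mult(4)[OF const sq]]])
  show "coeffs_in L1 E_density" unfolding E_density_def[abs_def]
    by (intro add(1) dsq mult(2)[OF const])
qed

lemma coeffs_in_Lam_density: "coeffs_in L1 Lam_density"
proof -
  have "coeffs_in bounded_measurable (\<lambda>_. [:-2:])"
    by (intro coeffs_in_pCons coeffs_in_0 linear_closed_bounded_measurable) (auto simp: bounded_measurable_def)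
  then show ?thesis unfolding Lam_density_def[abs_def]
    by (intro coeffs_in_add coeffs_in_mult_classes(2) linear_closed_L1 coeffs_in_densities)
qed

definition squares where
  "squares x = (v2 x + (1 - (kink x)\<^sup>2) * V x)\<^sup>2 + (kink x * V1 x - kink_deriv x * V x)\<^sup>2
      + (u2 x + sqrt 2 * (kink_deriv x * U x + kink x * U1 x))\<^sup>2 + (U1 x + sqrt 2 * kink x * U x)\<^sup>2"

text \<open>Found by integrating by parts all the mixed terms of the density and of the four squares.\<close>

definition flux where
  "flux x = sqrt 2 * kink x * (3 * (1 - (kink x)\<^sup>2) - 1) * (U x * U x) + (-2) * (1 - (kink x)\<^sup>2) * (U x * U1 x)
     + (- sqrt 2) * kink x * (U1 x * U1 x)
     + sqrt 2 / 2 * (kink x * (1 - (kink x)\<^sup>2)) * (V x * V x) + (-2) * (1 - (kink x)\<^sup>2) * (V x * V1 x)"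

text \<open>Since \<open>U1\<close> and \<open>V1\<close> have only L^2 derivatives,
  \<open>flux\<close> is differentiated through the product rule for primitives, and the algebraic
  identity recognises the resulting density.\<close>

lemma flux_is_primitive: "is_primitive flux (\<lambda>x. coeff (Lam_density x) 2 - squares x)"
proof -
  define w where "w = kink"
  define A where "A x = sqrt 2 * w x * (3 * (1 - (w x)\<^sup>2) - 1)" for x
  define A' where "A' x = (1 - (w x)\<^sup>2) * (3 * (1 - (w x)\<^sup>2) - 1) - 6 * (w x)\<^sup>2 * (1 - (w x)\<^sup>2)" for x
  define B where "B x = (-2) * (1 - (w x)\<^sup>2)" for x
  define B' where "B' x = 2 * sqrt 2 * w x * (1 - (w x)\<^sup>2)" for x
  define C where "C x = (- sqrt 2) * w x" for x
  define C' where "C' x = - (1 - (w x)\<^sup>2)" for x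
  define D where "D x = sqrt 2 / 2 * (w x * (1 - (w x)\<^sup>2))" for x
  define D' where "D' x = (1 - (w x)\<^sup>2)\<^sup>2 / 2 - (w x)\<^sup>2 * (1 - (w x)\<^sup>2)" for x
  \<comment> \<open>The slope is rewritten without \<open>sqrt 2\<close> in a denominator, so that
    \<open>sqrt 2 * sqrt 2 = 2\<close> suffices in the four derivative computations.\<close>
  have dw: "(w has_real_derivative sqrt 2 * (1 - (w x)\<^sup>2) / 2) (at x)" for x
  proof -
    have eq: "(1 - (kink x)\<^sup>2) / sqrt 2 = sqrt 2 * (1 - (kink x)\<^sup>2) / 2" by (simp add: field_simps)
    from kink_DERIV[of x] show ?thesis unfolding w_def eq .
  qed
  have cw: "continuous_on UNIV w" by (simp add: w_def kink_continuous)
  have q2: "sqrt 2 * (sqrt 2 * x) = 2 * x" for x by (simp flip: mult.assoc)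
  have "(A has_real_derivative A' x) (at x)" "(B has_real_derivative B' x) (at x)"
    "(C has_real_derivative C' x) (at x)" "(D has_real_derivative D' x) (at x)" for x
    unfolding A_def[abs_def] B_def[abs_def] C_def[abs_def] D_def[abs_def]
    by (auto intro!: derivative_eq_intros dw simp: A'_def B'_def C'_def D'_def power2_eq_square q2)
       (simp_all add: algebra_simps q2 add_divide_distrib diff_divide_distrib)
  moreover have "continuous_on UNIV A'" "continuous_on UNIV B'" "continuous_on UNIV C'" "continuous_on UNIV D'"
    unfolding A'_def[abs_def] B'_def[abs_def] C'_def[abs_def] D'_def[abs_def]
    by (auto intro!: continuous_intros cw)
  ultimately have p: "is_primitive A A'" "is_primitive B B'" "is_primitive C C'" "is_primitive D D'"
    by (auto intro: DERIV_is_primitive)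
  note m = is_primitive_mult
  \<comment> \<open>\<open>G\<close> keeps the unsimplified shape produced by the product rule; each
    line belongs to one term of \<open>flux\<close>.\<close>
  define G where "G x = A' x * (U x * U x) + A x * (U1 x * U x + U x * U1 x)
    + (B' x * (U x * U1 x) + B x * (U1 x * U1 x + U x * u2 x))
    + (C' x * (U1 x * U1 x) + C x * (u2 x * U1 x + U1 x * u2 x))
    + (D' x * (V x * V x) + D x * (V1 x * V x + V x * V1 x))
    + (B' x * (V x * V1 x) + B x * (V1 x * V1 x + V x * v2 x))" for x
  have "is_primitive flux G"
    unfolding flux_def[abs_def] G_def[abs_def] A_def[symmetric] B_def[symmetric] C_def[symmetric]
      D_def[symmetric] w_def[symmetric]
    by (intro is_primitive_add m[OF p(1)] m[OF p(2)] m[OF p(3)] m[OF p(4)] m prim)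
  moreover have "G x = coeff (Lam_density x) 2 - squares x" for x
  proof -
    have q: "(sqrt 2)\<^sup>2 = (2::real)" by simp
    have k: "2 * kink_deriv x = sqrt 2 * (1 - (kink x)\<^sup>2)" by (simp add: kink_deriv_def field_simps)
    have "coeff (Lam_density x) 2 = (u2 x)\<^sup>2 + (v2 x)\<^sup>2
      + 3 * ((kink x)\<^sup>2 * ((U1 x)\<^sup>2 + (V1 x)\<^sup>2) + 4 * kink x * kink_deriv x * U x * U1 x
             + (kink_deriv x)\<^sup>2 * ((U x)\<^sup>2 + (V x)\<^sup>2))
      + 2 * ((kink x * U1 x + kink_deriv x * U x)\<^sup>2 + 2 * kink x * kink_deriv x * (U x * U1 x + V x * V1 x))
      - 3 / 2 * (1 - kink x ^ 4) * ((U x)\<^sup>2 + (V x)\<^sup>2) + 6 * kink x ^ 4 * (U x)\<^sup>2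
      - 2 * ((U1 x)\<^sup>2 + (V1 x)\<^sup>2) + 2 * (1 - (kink x)\<^sup>2) * ((U x)\<^sup>2 + (V x)\<^sup>2) - 4 * (kink x)\<^sup>2 * (U x)\<^sup>2"
      unfolding Lam_density_def S_density_def E_density_def defect_def poly_defs
      by (simp add: numeral_2_eq_2 coeff_pCons)
         (simp add: power2_eq_square power4_eq_xxxx field_simps)
    also note second_variation_density_identity[OF q k, of "u2 x" "v2 x" "U1 x" "V1 x" "U x" "V x"]
    finally have "coeff (Lam_density x) 2 = squares x + G x"
      by (simp add: squares_def G_def A_def A'_def B_def B'_def C_def C'_def D_def D'_def w_def
            algebra_simps power2_eq_square)
    then show ?thesis by simp
  qed
  ultimately show ?thesis by (metis (no_types, lifting) ext)
qed

lemma squares_integrable: "integrable lborel squares"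
proof -
  note ad = linear_closedD(2)[OF linear_closed_L2] and cm = linear_closedD(3)[OF linear_closed_L2]
  note bm = bounded_measurable_mult_L2
  note b = bounded kink_bounded_measurable
  have "(\<lambda>x. v2 x + V x * (1 - (kink x)\<^sup>2)) \<in> L2"
    by (intro ad bm b L2 one_minus_kink_sq_L2)
  moreover have "(\<lambda>x. kink x * V1 x + (-1) * (V x * kink_deriv x)) \<in> L2"
    by (intro ad cm bm b L2 kink_deriv_L2)
  moreover have "(\<lambda>x. u2 x + sqrt 2 * (U x * kink_deriv x + kink x * U1 x)) \<in> L2"
    by (intro ad cm bm b L2 kink_deriv_L2)
  moreover have "(\<lambda>x. U1 x + sqrt 2 * (kink x * U x)) \<in> L2"
    by (intro ad cm bm b L2)
  ultimately show ?thesis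
    unfolding squares_def[abs_def] by (simp add: L2_def mult_ac)
qed

text \<open>Replaces the discussion of boundary terms: each term is a bounded function of the kink
  times a product of two L^2 functions, and an integrable primitive with integrable density has
  density of mean zero.\<close>

lemma flux_integrable: "integrable lborel flux"
proof -
  define w where "w = kink"
  have bm: "w \<in> bounded_measurable" by (simp add: w_def kink_bounded_measurable)
  note ad = linear_closedD(2)[OF linear_closed_bounded_measurable] and cm = linear_closedD(3)[OF linear_closed_bounded_measurable]
  have one: "(\<lambda>_. 1) \<in> bounded_measurable" by (auto simp: bounded_measurable_def)
  have phi: "(\<lambda>x. 1 - (w x)\<^sup>2) \<in> bounded_measurable"
    using ad[OF one cm[OF bounded_measurable_mult[OF bm bm], of "-1"]] by (simp add: power2_eq_square)
  have A: "(\<lambda>x. sqrt 2 * w x * (3 * (1 - (w x)\<^sup>2) + (-1) * 1)) \<in> bounded_measurable"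
    by (intro bounded_measurable_mult cm ad bm phi one)
  have B: "(\<lambda>x. (-2) * (1 - (w x)\<^sup>2)) \<in> bounded_measurable" by (intro cm phi)
  have C: "(\<lambda>x. (- sqrt 2) * w x) \<in> bounded_measurable" by (intro cm bm)
  have D: "(\<lambda>x. sqrt 2 / 2 * (w x * (1 - (w x)\<^sup>2))) \<in> bounded_measurable"
    by (intro bounded_measurable_mult cm bm phi)
  note i = bounded_measurable_mult_L1[OF _ L2_mult_L1]
  from i[OF A L2(1) L2(1)] i[OF B L2(1) L2(2)] i[OF C L2(2) L2(2)] i[OF D L2(4) L2(4)] i[OF B L2(4) L2(5)]
  have "integrable lborel (\<lambda>x. sqrt 2 * w x * (3 * (1 - (w x)\<^sup>2) + (-1) * 1) * (U x * U x) + (-2) * (1 - (w x)\<^sup>2) * (U x * U1 x)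
     + (- sqrt 2) * w x * (U1 x * U1 x)
     + sqrt 2 / 2 * (w x * (1 - (w x)\<^sup>2)) * (V x * V x) + (-2) * (1 - (w x)\<^sup>2) * (V x * V1 x))"
    unfolding L1_def mem_Collect_eq by (intro Bochner_Integration.integrable_add)
  then show ?thesis unfolding flux_def[abs_def] w_def by simp
qed

lemma second_coeff_nonneg: "0 \<le> (\<integral>x. coeff (Lam_density x) 2 \<partial>lborel)"
proof -
  have int: "integrable lborel (\<lambda>x. coeff (Lam_density x) 2)"
    using coeffs_in_Lam_density by (simp add: coeffs_in_def L1_def)
  have "(\<integral>x. coeff (Lam_density x) 2 - squares x \<partial>lborel) = 0"
    using int squares_integrable
    by (intro is_primitive_integral_zero[OF flux_is_primitive flux_integrable]) simp
  then have "(\<integral>x. coeff (Lam_density x) 2 \<partial>lborel) = (\<integral>x. squares x \<partial>lborel)"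
    using int squares_integrable by simp
  also have "\<dots> \<ge> 0" by (intro Bochner_Integration.integral_nonneg) (simp add: squares_def)
  finally show ?thesis .
qed

section \<open>Evaluation of the functionals on a perturbed kink\<close>

context
  fixes f :: "real \<Rightarrow> complex" and s :: real
  assumes meas: "f \<in> borel_measurable borel"
    and f_AE: "AE x in lborel. f x = Complex (kink x + s * U x) (s * V x)"
begin

lemma profile_weak_derivs:
  "has_weak_deriv f (\<lambda>x. Complex (kink_deriv x + s * U1 x) (s * V1 x))"
  "has_weak_deriv (\<lambda>x. Complex (kink_deriv x + s * U1 x) (s * V1 x))
     (\<lambda>x. Complex (kink_deriv2 x + s * u2 x) (s * v2 x))"
  and profile_L2: "(\<lambda>x. Complex (kink_deriv x + s * U1 x) (s * V1 x)) \<in> L2"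
  "(\<lambda>x. Complex (kink_deriv2 x + s * u2 x) (s * v2 x)) \<in> L2"
proof -
  note ad = linear_closedD(2)[OF linear_closed_L2] and cm = linear_closedD(3)[OF linear_closed_L2]
  show l1: "(\<lambda>x. Complex (kink_deriv x + s * U1 x) (s * V1 x)) \<in> L2"
    and l2: "(\<lambda>x. Complex (kink_deriv2 x + s * u2 x) (s * v2 x)) \<in> L2"
    by (intro Complex_L2 ad cm L2 kink_deriv_L2)+
  note p = is_primitive_has_weak_deriv is_primitive_add is_primitive_cmult prim
    kink_is_primitive kink_deriv_is_primitive
  have *: "has_weak_deriv (\<lambda>x. Complex (kink x + s * U x) (s * V x))
      (\<lambda>x. Complex (kink_deriv x + s * U1 x) (s * V1 x))"
    unfolding has_weak_deriv_complex_iff complex.sel by (intro conjI p)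
  show "has_weak_deriv (\<lambda>x. Complex (kink_deriv x + s * U1 x) (s * V1 x))
     (\<lambda>x. Complex (kink_deriv2 x + s * u2 x) (s * v2 x))"
    unfolding has_weak_deriv_complex_iff complex.sel by (intro conjI p)
  show "has_weak_deriv f (\<lambda>x. Complex (kink_deriv x + s * U1 x) (s * V1 x))"
    by (rule has_weak_deriv_cong_AE[OF *]) (use f_AE meas l1 in \<open>auto simp: L2_def\<close>)
qed

text \<open>The second derivative is taken of the chosen function \<open>weak_deriv f\<close>, not
  of its continuous representative. The weak derivative relation must first be carried over to that
  function before uniqueness can be applied again.\<close>

lemma weak_deriv_profile:
  shows "AE x in lborel. weak_deriv f x = Complex (kink_deriv x + s * U1 x) (s * V1 x)"
    and "AE x in lborel. weak_deriv (weak_deriv f) x = Complex (kink_deriv2 x + s * u2 x) (s * v2 x)"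
    and "weak_deriv f \<in> borel_measurable borel" "weak_deriv (weak_deriv f) \<in> borel_measurable borel"
    and "has_weak_deriv (weak_deriv f) (\<lambda>x. Complex (kink_deriv2 x + s * u2 x) (s * v2 x))"
proof -
  note d = weak_deriv_AE_eq[OF profile_weak_derivs(1)]
  show ae: "AE x in lborel. weak_deriv f x = Complex (kink_deriv x + s * U1 x) (s * V1 x)" by (rule d)
  show m: "weak_deriv f \<in> borel_measurable borel"
    using d(1) by (simp add: has_weak_deriv_def locally_integrable_def)
  have "AE x in lborel. Complex (kink_deriv x + s * U1 x) (s * V1 x) = weak_deriv f x"
    using ae by eventually_elim simp
  then show h: "has_weak_deriv (weak_deriv f) (\<lambda>x. Complex (kink_deriv2 x + s * u2 x) (s * v2 x))"
    by (rule has_weak_deriv_cong_AE[OF profile_weak_derivs(2)])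
       (use m profile_L2 in \<open>auto simp: L2_def\<close>)
  note d2 = weak_deriv_AE_eq[OF h]
  show "AE x in lborel. weak_deriv (weak_deriv f) x = Complex (kink_deriv2 x + s * u2 x) (s * v2 x)" by (rule d2)
  show "weak_deriv (weak_deriv f) \<in> borel_measurable borel"
    using d2(1) by (simp add: has_weak_deriv_def locally_integrable_def)
qed

lemma poly_defect: "poly (defect x) s = 1 - (cmod (Complex (kink x + s * U x) (s * V x)))\<^sup>2"
  unfolding defect_eq cmod_power2 by (simp add: re0_def im0_def power2_eq_square algebra_simps)

text \<open>As the kink does not decay, \<open>f\<close> is placed only in local L^2, through its
  continuous representative; its derivatives are globally in L^2. The potential condition is the
  evaluation of \<open>defect\<close> at \<open>s\<close>.\<close>

lemma profile_in_X: "f \<in> X"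
proof -
  note [measurable] = meas weak_deriv_profile(3)
  have "continuous_on UNIV (\<lambda>x. Complex (kink x + s * U x) (s * V x))"
    unfolding complex_eq
    by (intro continuous_intros kink_continuous is_primitive_continuous[OF prim(1)] is_primitive_continuous[OF prim(3)])
  then have "(\<lambda>x. Complex (kink x + s * U x) (s * V x)) \<in> L2_loc" by (rule continuous_L2_loc)
  moreover have "AE x in lborel. Complex (kink x + s * U x) (s * V x) = f x" using f_AE by eventually_elim simp
  ultimately have "f \<in> L2_loc" using meas by (rule L2_loc_cong_AE)
  then have "f \<in> sobolev_H_loc 2"
    using profile_weak_derivs profile_L2 L2_subset_L2_loc by (auto simp: numeral_2_eq_2)
  moreover have "weak_deriv f \<in> L2"
    by (rule L2_cong_AE[OF profile_L2(1)]) (use weak_deriv_profile(1) in \<open>auto elim: eventually_mono\<close>)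
  then have "weak_deriv f \<in> sobolev_H 1"
    using weak_deriv_profile(5) profile_L2(2) by auto
  moreover have "(\<lambda>x. poly (defect x) s) \<in> L2"
    by (rule coeffs_in_poly[OF linear_closed_L2 coeffs_in_densities(3)])
  then have "(\<lambda>x. 1 - (cmod (f x))\<^sup>2) \<in> L2"
    by (rule L2_cong_AE) (use f_AE in \<open>auto simp: poly_defect elim: eventually_mono\<close>)
  ultimately show ?thesis by (simp add: X_def)
qed

lemma Lam_profile: "Lam f = (\<integral>x. poly (Lam_density x) s \<partial>lborel)"
proof -
  note [measurable] = meas weak_deriv_profile(3,4)
  have int: "integrable lborel (\<lambda>x. poly (S_density x) s)" "integrable lborel (\<lambda>x. poly (E_density x) s)"
    using coeffs_in_poly[OF linear_closed_L1 coeffs_in_densities(1)]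
      coeffs_in_poly[OF linear_closed_L1 coeffs_in_densities(2)] by (simp_all add: L1_def)
  have [measurable]: "(\<lambda>x. poly (S_density x) s) \<in> borel_measurable borel" "(\<lambda>x. poly (E_density x) s) \<in> borel_measurable borel"
    using int[THEN borel_measurable_integrable] by simp_all
  have pE: "poly (E_density x) s = (cmod (Complex (kink_deriv x + s * U1 x) (s * V1 x)))\<^sup>2
      + 1/2 * (1 - (cmod (Complex (kink x + s * U x) (s * V x)))\<^sup>2)\<^sup>2" for x
    unfolding E_density_def poly_add poly_mult poly_defect
    by (simp add: poly_defs cmod_power2) (simp add: power2_eq_square algebra_simps)
  have "E f = (\<integral>x. poly (E_density x) s \<partial>lborel)"
    unfolding E_def
  proof (rule integral_cong_AE)
    show "AE x in lborel. (cmod (weak_deriv f x))\<^sup>2 + 1/2 * (1 - (cmod (f x))\<^sup>2)\<^sup>2 = poly (E_density x) s"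
      using f_AE weak_deriv_profile(1) unfolding pE by eventually_elim simp
  qed measurable
  moreover have pS: "poly (S_density x) s = (cmod (Complex (kink_deriv2 x + s * u2 x) (s * v2 x)))\<^sup>2
      + 3 * (cmod F)\<^sup>2 * (cmod G)\<^sup>2 + 1/2 * (Re (cnj F * G + F * cnj G))\<^sup>2
      + (1 - (cmod F)\<^sup>2)\<^sup>2 * (1 + 1/2 * (cmod F)\<^sup>2)"
    if "F = Complex (kink x + s * U x) (s * V x)" "G = Complex (kink_deriv x + s * U1 x) (s * V1 x)" for x F G
    unfolding S_density_def poly_add poly_mult poly_defect that
    by (simp add: poly_defs cmod_power2) (simp add: power2_eq_square algebra_simps)
  have [measurable]: "cnj \<in> borel_measurable borel"
    by (intro borel_measurable_continuous_onI continuous_intros)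
  have "S f = (\<integral>x. poly (S_density x) s \<partial>lborel)"
    unfolding S_def
  proof (rule integral_cong_AE)
    show "AE x in lborel. (cmod (weak_deriv (weak_deriv f) x))\<^sup>2
               + 3 * (cmod (f x))\<^sup>2 * (cmod (weak_deriv f x))\<^sup>2
               + 1/2 * (Re (cnj (f x) * weak_deriv f x + f x * cnj (weak_deriv f x)))\<^sup>2
               + (1 - (cmod (f x))\<^sup>2)\<^sup>2 * (1 + 1/2 * (cmod (f x))\<^sup>2) = poly (S_density x) s"
      using f_AE weak_deriv_profile(1,2)
    proof eventually_elim
      case (elim x)
      from pS[OF elim(1,2)] elim(3) show ?case by simp
    qed
  qed measurable
  \<comment> \<open>Integrability of both densities is what allows \<open>S - 2 * E\<close> to be
    written as a single integral.\<close>
  ultimately show ?thesis using int by (simp add: Lam_def Lam_density_def)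
qed

end

end

theorem proposition1p1:
  fixes u v :: "real \<Rightarrow> real"
  assumes "u \<in> sobolev_H 2" and "v \<in> sobolev_H 2"
  shows "(\<forall>s. perturb u0 (\<lambda>x. Complex (u x) (v x)) s \<in> X) \<and>
         twice_differentiable_at (\<lambda>s. Lam (perturb u0 (\<lambda>x. Complex (u x) (v x)) s)) 0 \<and>
         second_variation Lam u0 (\<lambda>x. Complex (u x) (v x)) \<ge> 0"
proof -
  let ?f = "perturb u0 (\<lambda>x. Complex (u x) (v x))"
  obtain U U1 u2 where U: "is_primitive U U1" "is_primitive U1 u2" "AE x in lborel. u x = U x"
    "U \<in> L2" "U1 \<in> L2" "u2 \<in> L2"
    using sobolev_H2_primitives[OF assms(1)] by metis
  obtain V V1 v2 where V: "is_primitive V V1" "is_primitive V1 v2" "AE x in lborel. v x = V x"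
    "V \<in> L2" "V1 \<in> L2" "v2 \<in> L2"
    using sobolev_H2_primitives[OF assms(2)] by metis
  interpret H2_perturbation U U1 u2 V V1 v2
    using U V by unfold_locales
  have f_eq: "?f s x = Complex (kink x + s * u x) (s * v x)" for s x
    by (simp add: perturb_def u0_def kink_def complex_eq_iff)
  have [measurable]: "u \<in> borel_measurable borel" "v \<in> borel_measurable borel" "kink \<in> borel_measurable borel"
    using assms kink_bounded_measurable by (auto simp: numeral_2_eq_2 L2_def bounded_measurable_def)
  have meas: "?f s \<in> borel_measurable borel" for s
    unfolding f_eq[abs_def] by (intro Complex_measurable) measurable
  have ae: "AE x in lborel. ?f s x = Complex (kink x + s * U x) (s * V x)" for s
    using U(3) V(3) by eventually_elim (simp add: f_eq)
  obtain Q where Q: "\<And>s. (\<integral>x. poly (Lam_density x) s \<partial>lborel) = poly Q s"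
    "\<And>k. coeff Q k = (\<integral>x. coeff (Lam_density x) k \<partial>lborel)"
    using coeffs_in_L1_integral[OF coeffs_in_Lam_density] by metis
  \<comment> \<open>The equality holds for every \<open>s\<close>, hence as functions, so both
    differentiability and the iterated \<open>deriv\<close> can be read off from
    \<open>Q\<close>.\<close>
  have "(\<lambda>s. Lam (?f s)) = poly Q"
    using Lam_profile[OF meas ae] Q(1) by (simp add: fun_eq_iff)
  then show ?thesis
    using profile_in_X[OF meas ae] twice_differentiable_at_poly[of Q 0] second_coeff_nonneg
    by (simp add: second_variation_def deriv_deriv_poly_0 Q(2))
qed

end
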